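(* Let $\mathbb{G}\leq S_N^+$ be a quantum permutation group. For any partition $\mathcal{P}$ of $\{1,\dots,N\}$, the set $$\mathbb{G}_{\mathcal{P}}:=\{\varphi\in\mathcal{S}(C(\mathbb{G})): \varphi(u_{ij})=0\text{ for all }i\not\sim_{\mathcal{P}}j\}$$ is a quasi-subgroup, i.e. there is an idempotent state $\phi$ on $C(\mathbb{G})$ with $\mathbb{G}_{\mathcal{P}}=\{\varphi\in\mathcal{S}(C(\mathbb{G})):\varphi\star\phi=\phi=\phi\star\varphi\}$.
   Context: A compact quantum group $\mathbb{G}$ is given by a unital $\mathrm{C}^*$-algebra $C(\mathbb{G})$ with a coassociative unital $*$-homomorphism $\Delta:C(\mathbb{G})\to C(\mathbb{G})\otimes C(\mathbb{G})$ (minimal tensor product) such that $\Delta(C(\mathbb{G}))(\mathds{1}\otimes C(\mathbb{G}))$ and $\Delta(C(\mathbb{G}))(C(\mathbb{G})\otimes \mathds{1})$ are dense (linear span) in $C(\mathbb{G})\otimes C(\mathbb{G})$. A quantum permutation group $\mathbb{G}\leq S_N^+$ is a compact quantum group with a magic unitary $u\in M_N(C(\mathbb{G}))$ (entries are projections; each row and column sums to the unit) whose entries generate $C(\mathbb{G})$ as a $\mathrm{C}^*$-algebra and satisfy $\Delta(u_{ij})=\sum_{k}u_{ik}\otimes u_{kj}$. $C(\mathbb{G})$ is assumed universal, i.e. the universal (maximal) $\mathrm{C}^*$-completion of the dense Hopf $*$-algebra generated by the $u_{ij}$; so it has a counit, a character $\varepsilon$ with $\varepsilon(u_{ij})=\delta_{i,j}$.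 $\mathcal{S}(C(\mathbb{G}))$ is the state space; convolution is $\varphi_1\star\varphi_2:=(\varphi_1\otimes\varphi_2)\Delta$; a state $\phi$ is idempotent if $\phi\star\phi=\phi$. $\sim_{\mathcal{P}}$ is the equivalence relation on $\{1,\dots,N\}$ whose classes are the blocks of $\mathcal{P}$. *)

theory Defs
  imports "HOL-Analysis.Analysis" "HOL-Library.Disjoint_Sets"
begin

section \<open>Unital C*-algebras and states\<close>

text \<open>A type of this class is a non-zero unital complex C*-algebra. Its norm, completeness and
  real vector space structure come from the library classes; \<open>adj\<close> is the involution.\<close>

class cstar_algebra = real_normed_algebra_1 + banach +
  fixes scaleC :: "complex \<Rightarrow> 'a \<Rightarrow> 'a" (infixr "*\<^sub>C" 75)
    and adj :: "'a \<Rightarrow> 'a"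
  assumes scaleC_add_right: "c *\<^sub>C (x + y) = c *\<^sub>C x + c *\<^sub>C y"
    and scaleC_add_left: "(c + d) *\<^sub>C x = c *\<^sub>C x + d *\<^sub>C x"
    and scaleC_scaleC: "c *\<^sub>C (d *\<^sub>C x) = (c * d) *\<^sub>C x"
    and scaleC_of_real: "complex_of_real r *\<^sub>C x = r *\<^sub>R x"
    and scaleC_mult_left: "(c *\<^sub>C x) * y = c *\<^sub>C (x * y)"
    and scaleC_mult_right: "x * (c *\<^sub>C y) = c *\<^sub>C (x * y)"
    and norm_scaleC: "norm (c *\<^sub>C x) = cmod c * norm x"
    and adj_adj: "adj (adj x) = x"
    and adj_add: "adj (x + y) = adj x + adj y"
    and adj_scaleC: "adj (c *\<^sub>C x) = cnj c *\<^sub>C adj x"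
    and adj_mult: "adj (x * y) = adj y * adj x"
    and cstar_identity: "norm (adj x * x) = (norm x)\<^sup>2"

definition states :: "('a::cstar_algebra \<Rightarrow> complex) set" where
  "states = {\<phi>. bounded_linear \<phi> \<and> (\<forall>c x. \<phi> (c *\<^sub>C x) = c * \<phi> x)
     \<and> (\<forall>x. \<phi> (adj x * x) \<in> \<real>\<^sub>\<ge>\<^sub>0) \<and> onorm \<phi> = 1}"

definition unital_star_hom :: "('a::cstar_algebra \<Rightarrow> 'b::cstar_algebra) \<Rightarrow> bool" where
  "unital_star_hom f \<longleftrightarrow>
     (\<forall>x y. f (x + y) = f x + f y) \<and> (\<forall>c x. f (c *\<^sub>C x) = c *\<^sub>C f x) \<and>
     (\<forall>x y. f (x * y) = f x * f y) \<and> (\<forall>x. f (adj x) = adj (f x)) \<and> f 1 = 1"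

text \<open>The unital *-subalgebra generated by a set.\<close>

inductive_set gen_star_algebra :: "'a::cstar_algebra set \<Rightarrow> 'a set" for G where
  gen: "x \<in> G \<Longrightarrow> x \<in> gen_star_algebra G"
| one: "1 \<in> gen_star_algebra G"
| add: "x \<in> gen_star_algebra G \<Longrightarrow> y \<in> gen_star_algebra G \<Longrightarrow> x + y \<in> gen_star_algebra G"
| scale: "x \<in> gen_star_algebra G \<Longrightarrow> c *\<^sub>C x \<in> gen_star_algebra G"
| mult: "x \<in> gen_star_algebra G \<Longrightarrow> y \<in> gen_star_algebra G \<Longrightarrow> x * y \<in> gen_star_algebra G"
| adj: "x \<in> gen_star_algebra G \<Longrightarrow> adj x \<in> gen_star_algebra G"

definition cstar_seminorm_on :: "'a::cstar_algebra set \<Rightarrow> ('a \<Rightarrow> real) \<Rightarrow> bool" where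
  "cstar_seminorm_on H p \<longleftrightarrow>
     (\<forall>x\<in>H. 0 \<le> p x) \<and>
     (\<forall>x\<in>H. \<forall>y\<in>H. p (x + y) \<le> p x + p y) \<and>
     (\<forall>c. \<forall>x\<in>H. p (c *\<^sub>C x) = cmod c * p x) \<and>
     (\<forall>x\<in>H. \<forall>y\<in>H. p (x * y) \<le> p x * p y) \<and>
     (\<forall>x\<in>H. p (adj x * x) = (p x)\<^sup>2)"


section \<open>The minimal tensor product\<close>

text \<open>A list \<open>[(a\<^sub>1,b\<^sub>1),\<dots>,(a\<^sub>n,b\<^sub>n)]\<close> stands for the element \<open>\<Sum>\<^sub>k a\<^sub>k \<otimes> b\<^sub>k\<close> of the algebraic
  tensor product.\<close>

definition tensor_sum :: "('a \<Rightarrow> 'b \<Rightarrow> 'c::monoid_add) \<Rightarrow> ('a \<times> 'b) list \<Rightarrow> 'c" where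
  "tensor_sum tens xs = (\<Sum>(a, b)\<leftarrow>xs. tens a b)"

definition tensor_mult :: "('a::times \<times> 'b::times) list \<Rightarrow> ('a \<times> 'b) list \<Rightarrow> ('a \<times> 'b) list" where
  "tensor_mult xs ys = [(a * c, b * d). (a, b) \<leftarrow> xs, (c, d) \<leftarrow> ys]"

text \<open>The inner product, in \<open>H\<^sub>\<phi> \<otimes> H\<^sub>\<psi>\<close>, of the vectors represented by two elements of the
  algebraic tensor product, where \<open>H\<^sub>\<phi>\<close> and \<open>H\<^sub>\<psi>\<close> are the GNS spaces: on \<open>H\<^sub>\<phi>\<close> one has
  \<open>\<langle>a, c\<rangle> = \<phi>(a\<^sup>* c)\<close>.\<close>

definition gns_inner ::
  "('a::cstar_algebra \<Rightarrow> complex) \<Rightarrow> ('b::cstar_algebra \<Rightarrow> complex) \<Rightarrow>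
    ('a \<times> 'b) list \<Rightarrow> ('a \<times> 'b) list \<Rightarrow> complex" where
  "gns_inner \<phi> \<psi> xs ys = (\<Sum>(a, b)\<leftarrow>xs. \<Sum>(c, d)\<leftarrow>ys. \<phi> (adj a * c) * \<psi> (adj b * d))"

text \<open>\<open>r\<close> bounds the operator norm of \<open>(\<pi>\<^sub>\<phi> \<otimes> \<pi>\<^sub>\<psi>)(t)\<close> for all states \<open>\<phi>\<close>, \<open>\<psi>\<close>, where \<open>t\<close> is the
  element represented by \<open>xs\<close> and \<open>\<pi>\<^sub>\<phi>\<close>, \<open>\<pi>\<^sub>\<psi>\<close> are the GNS representations. As every
  representation is a direct sum of cyclic ones, the least such \<open>r\<close> is the minimal (spatial)
  C*-norm of \<open>t\<close>, i.e. the supremum of \<open>\<parallel>(\<pi> \<otimes> \<rho>)(t)\<parallel>\<close> over all representations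
  \<open>\<pi>\<close>, \<open>\<rho>\<close> of the two factors.\<close>

definition spatial_bound ::
  "('a::cstar_algebra \<times> 'b::cstar_algebra) list \<Rightarrow> real \<Rightarrow> bool" where
  "spatial_bound xs r \<longleftrightarrow> 0 \<le> r \<and>
     (\<forall>\<phi>\<in>states. \<forall>\<psi>\<in>states. \<forall>ys.
        Re (gns_inner \<phi> \<psi> (tensor_mult xs ys) (tensor_mult xs ys)) \<le> r\<^sup>2 * Re (gns_inner \<phi> \<psi> ys ys))"

definition is_spatial_norm ::
  "('a::cstar_algebra \<times> 'b::cstar_algebra) list \<Rightarrow> real \<Rightarrow> bool" where
  "is_spatial_norm xs r \<longleftrightarrow> spatial_bound xs r \<and> (\<forall>s. spatial_bound xs s \<longrightarrow> r \<le> s)"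

text \<open>The third algebra, together with the map \<open>(a, b) \<mapsto> a \<otimes> b\<close>, is the completion of the
  algebraic tensor product of the first two in the minimal norm. Injectivity of the algebraic tensor
  product follows from \<open>norm_tensor\<close>. The library's real span is used in \<open>dense_tensors\<close> (and below);
  it is also the complex span because the spanning set is closed under complex multiples.\<close>

locale min_tensor =
  fixes tens :: "'a::cstar_algebra \<Rightarrow> 'b::cstar_algebra \<Rightarrow> 'c::cstar_algebra"
  assumes tensor_add_left: "tens (a + a') b = tens a b + tens a' b"
    and tensor_add_right: "tens a (b + b') = tens a b + tens a b'"
    and tensor_scale_left: "tens (c *\<^sub>C a) b = c *\<^sub>C tens a b"
    and tensor_scale_right: "tens a (c *\<^sub>C b) = c *\<^sub>C tens a b"
    and tensor_times: "tens a b * tens a' b' = tens (a * a') (b * b')"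
    and tensor_adj: "adj (tens a b) = tens (adj a) (adj b)"
    and tensor_one: "tens 1 1 = 1"
    and norm_tensor: "is_spatial_norm xs (norm (tensor_sum tens xs))"
    and dense_tensors: "closure (span {tens a b | a b. True}) = UNIV"

text \<open>The continuous linear map on the tensor product with prescribed values
  \<open>a \<otimes> b \<mapsto> f a b\<close>; it is unique by density of the linear span of the pure tensors.\<close>

definition tensor_ext ::
  "('a::cstar_algebra \<Rightarrow> 'b::cstar_algebra \<Rightarrow> 'c::cstar_algebra) \<Rightarrow>
    ('a \<Rightarrow> 'b \<Rightarrow> 'd::real_normed_vector) \<Rightarrow> 'c \<Rightarrow> 'd" where
  "tensor_ext tens f = (THE F. bounded_linear F \<and> (\<forall>a b. F (tens a b) = f a b))"


section \<open>Compact quantum groups\<close>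

text \<open>\<open>tens\<close> gives \<open>A \<otimes> A\<close>, while \<open>tensL\<close> and \<open>tensR\<close> give the triple tensor product as
  \<open>(A \<otimes> A) \<otimes> A\<close> and as \<open>A \<otimes> (A \<otimes> A)\<close>, identified via \<open>tensor_assoc\<close>. In \<open>coassoc\<close> the two
  sides are \<open>(\<Delta> \<otimes> id) \<circ> \<Delta>\<close> and \<open>(id \<otimes> \<Delta>) \<circ> \<Delta>\<close>.\<close>

locale compact_quantum_group =
  tens: min_tensor tens + tensL: min_tensor tensL + tensR: min_tensor tensR
  for tens :: "'a::cstar_algebra \<Rightarrow> 'a \<Rightarrow> 'b::cstar_algebra"
    and tensL :: "'b \<Rightarrow> 'a \<Rightarrow> 'c::cstar_algebra"
    and tensR :: "'a \<Rightarrow> 'b \<Rightarrow> 'c" +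
  fixes \<Delta> :: "'a \<Rightarrow> 'b"
  assumes tensor_assoc: "tensL (tens a b) c = tensR a (tens b c)"
    and comult_hom: "unital_star_hom \<Delta>"
    and coassoc: "tensor_ext tens (\<lambda>a b. tensL (\<Delta> a) b) (\<Delta> x) =
                  tensor_ext tens (\<lambda>a b. tensR a (\<Delta> b)) (\<Delta> x)"
    and dense_right: "closure (span {\<Delta> a * tens 1 b | a b. True}) = UNIV"
    and dense_left: "closure (span {\<Delta> a * tens b 1 | a b. True}) = UNIV"

text \<open>\<open>H\<close> is a Hopf *-algebra under the restriction of the unital *-homomorphism \<open>\<Delta>\<close>, with
  counit \<open>\<epsilon>\<close> and antipode \<open>S\<close>. The list \<open>xs\<close> is an arbitrary way of writing \<open>\<Delta> x\<close> as an element
  \<open>\<Sum>\<^sub>k a\<^sub>k \<otimes> b\<^sub>k\<close> of the algebraic tensor product of \<open>H\<close> with itself. The values of \<open>\<epsilon>\<close> and \<open>S\<close>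
  outside \<open>H\<close> are irrelevant.\<close>

definition hopf_star_algebra_on ::
  "('a::cstar_algebra \<Rightarrow> 'a \<Rightarrow> 'b::cstar_algebra) \<Rightarrow> ('a \<Rightarrow> 'b) \<Rightarrow> 'a set \<Rightarrow> bool" where
  "hopf_star_algebra_on tens \<Delta> H \<longleftrightarrow>
     (\<forall>x\<in>H. \<exists>xs. set xs \<subseteq> H \<times> H \<and> \<Delta> x = tensor_sum tens xs) \<and>
     (\<exists>(\<epsilon> :: 'a \<Rightarrow> complex) (S :: 'a \<Rightarrow> 'a).
        (\<forall>x\<in>H. \<forall>y\<in>H. \<epsilon> (x + y) = \<epsilon> x + \<epsilon> y) \<and> (\<forall>c. \<forall>x\<in>H. \<epsilon> (c *\<^sub>C x) = c * \<epsilon> x) \<and>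
        (\<forall>x\<in>H. \<forall>y\<in>H. \<epsilon> (x * y) = \<epsilon> x * \<epsilon> y) \<and> \<epsilon> 1 = 1 \<and>
        (\<forall>x\<in>H. S x \<in> H) \<and>
        (\<forall>x\<in>H. \<forall>y\<in>H. S (x + y) = S x + S y) \<and> (\<forall>c. \<forall>x\<in>H. S (c *\<^sub>C x) = c *\<^sub>C S x) \<and>
        (\<forall>x\<in>H. \<forall>xs. set xs \<subseteq> H \<times> H \<and> \<Delta> x = tensor_sum tens xs \<longrightarrow>
           (\<Sum>(a, b)\<leftarrow>xs. \<epsilon> a *\<^sub>C b) = x \<and>
           (\<Sum>(a, b)\<leftarrow>xs. \<epsilon> b *\<^sub>C a) = x \<and>
           (\<Sum>(a, b)\<leftarrow>xs. S a * b) = \<epsilon> x *\<^sub>C 1 \<and>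
           (\<Sum>(a, b)\<leftarrow>xs. a * S b) = \<epsilon> x *\<^sub>C 1))"

definition convolution ::
  "('a::cstar_algebra \<Rightarrow> 'a \<Rightarrow> 'b::cstar_algebra) \<Rightarrow> ('a \<Rightarrow> 'b) \<Rightarrow>
    ('a \<Rightarrow> complex) \<Rightarrow> ('a \<Rightarrow> complex) \<Rightarrow> 'a \<Rightarrow> complex" where
  "convolution tens \<Delta> \<phi>\<^sub>1 \<phi>\<^sub>2 = tensor_ext tens (\<lambda>a b. \<phi>\<^sub>1 a * \<phi>\<^sub>2 b) \<circ> \<Delta>"

definition idempotent_state ::
  "('a::cstar_algebra \<Rightarrow> 'a \<Rightarrow> 'b::cstar_algebra) \<Rightarrow> ('a \<Rightarrow> 'b) \<Rightarrow> ('a \<Rightarrow> complex) \<Rightarrow> bool" where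
  "idempotent_state tens \<Delta> \<phi> \<longleftrightarrow> \<phi> \<in> states \<and> convolution tens \<Delta> \<phi> \<phi> = \<phi>"

definition quasi_subgroup ::
  "('a::cstar_algebra \<Rightarrow> 'a \<Rightarrow> 'b::cstar_algebra) \<Rightarrow> ('a \<Rightarrow> 'b) \<Rightarrow> ('a \<Rightarrow> complex) set \<Rightarrow> bool" where
  "quasi_subgroup tens \<Delta> X \<longleftrightarrow>
     (\<exists>\<phi>. idempotent_state tens \<Delta> \<phi> \<and>
        X = {\<psi> \<in> states. convolution tens \<Delta> \<psi> \<phi> = \<phi> \<and> \<phi> = convolution tens \<Delta> \<phi> \<psi>})"


section \<open>Quantum permutation groups\<close>

definition magic_unitary :: "nat \<Rightarrow> (nat \<Rightarrow> nat \<Rightarrow> 'a::cstar_algebra) \<Rightarrow> bool" where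
  "magic_unitary N u \<longleftrightarrow>
     (\<forall>i\<in>{1..N}. \<forall>j\<in>{1..N}. adj (u i j) = u i j \<and> u i j * u i j = u i j) \<and>
     (\<forall>i\<in>{1..N}. (\<Sum>j=1..N. u i j) = 1) \<and>
     (\<forall>j\<in>{1..N}. (\<Sum>i=1..N. u i j) = 1)"

abbreviation coefficient_algebra :: "nat \<Rightarrow> (nat \<Rightarrow> nat \<Rightarrow> 'a::cstar_algebra) \<Rightarrow> 'a set" where
  "coefficient_algebra N u \<equiv> gen_star_algebra {u i j | i j. i \<in> {1..N} \<and> j \<in> {1..N}}"

text \<open>Assumption \<open>universal\<close>: every C*-seminorm on the Hopf *-algebra is dominated by the given
  norm, so the given norm is the largest C*-norm there and, with \<open>generates\<close>, the algebra is the
  universal C*-completion.\<close>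

locale quantum_permutation_group = compact_quantum_group tens tensL tensR \<Delta>
  for tens :: "'a::cstar_algebra \<Rightarrow> 'a \<Rightarrow> 'b::cstar_algebra"
    and tensL :: "'b \<Rightarrow> 'a \<Rightarrow> 'c::cstar_algebra"
    and tensR :: "'a \<Rightarrow> 'b \<Rightarrow> 'c"
    and \<Delta> :: "'a \<Rightarrow> 'b" +
  fixes N :: nat and u :: "nat \<Rightarrow> nat \<Rightarrow> 'a"
  assumes magic: "magic_unitary N u"
    and generates: "closure (coefficient_algebra N u) = UNIV"
    and comult_u: "i \<in> {1..N} \<Longrightarrow> j \<in> {1..N} \<Longrightarrow> \<Delta> (u i j) = (\<Sum>k=1..N. tens (u i k) (u k j))"
    and hopf: "hopf_star_algebra_on tens \<Delta> (coefficient_algebra N u)"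
    and universal: "cstar_seminorm_on (coefficient_algebra N u) p \<Longrightarrow>
                    x \<in> coefficient_algebra N u \<Longrightarrow> p x \<le> norm x"

definition partition_states ::
  "nat \<Rightarrow> (nat \<Rightarrow> nat \<Rightarrow> 'a::cstar_algebra) \<Rightarrow> nat set set \<Rightarrow> ('a \<Rightarrow> complex) set" where
  "partition_states N u P =
     {\<phi> \<in> states. \<forall>i\<in>{1..N}. \<forall>j\<in>{1..N}. \<not> (\<exists>B\<in>P. i \<in> B \<and> j \<in> B) \<longrightarrow> \<phi> (u i j) = 0}"

end

theory Submission
  imports Defs
begin

text \<open>Let \<open>v\<close> be a tensor power of the fundamental representation \<open>u\<close>. Since \<open>v\<close> is unitary,
  Cauchy--Schwarz makes \<open>\<phi>(v)\<close> a contraction for every state \<open>\<phi>\<close>, and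
  \<open>(\<phi> \<star> \<psi>)(v) = \<phi>(v) \<psi>(v)\<close>. The set \<open>K\<close> of states vanishing on the \<open>u i j\<close> with \<open>i\<close> and
  \<open>j\<close> in different blocks is weak-* compact, convex, closed under convolution, and contains the
  counit. Cesaro means of convolution powers give, for each \<open>\<omega> \<in> K\<close>, some \<open>h \<in> K\<close> with
  \<open>\<omega> \<star> h = h\<close>. If \<open>\<omega>\<close> is an average of \<open>\<phi>\<close> and \<open>\<psi>\<close>, then strict convexity of the Hilbert space
  norm yields \<open>\<phi> \<star> h = h\<close> and \<open>\<psi> \<star> h = h\<close>, so by compactness one \<open>h \<in> K\<close> works for all of \<open>K\<close>. The
  contractive idempotents \<open>h(v)\<close> are orthogonal projections, which makes \<open>h\<close> right invariant as well.
  Conversely, if \<open>\<psi> \<star> h = h\<close> and \<open>i\<close>, \<open>j\<close> lie in different blocks, then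
  \<open>0 = h(u i j) \<ge> \<psi>(u i j) h(u j j) \<ge> 0\<close> with \<open>h(u j j) > 0\<close>, so \<open>\<psi> \<in> K\<close>.\<close>

section \<open>C*-algebras and positive functionals\<close>

lemma scaleC_one [simp]: "1 *\<^sub>C x = (x :: 'a::cstar_algebra)"
  using scaleC_of_real[of 1 x] by simp

lemma scaleC_zero_left [simp]: "0 *\<^sub>C x = (0 :: 'a::cstar_algebra)"
  using scaleC_of_real[of 0 x] by simp

lemma scaleC_zero_right [simp]: "c *\<^sub>C 0 = (0 :: 'a::cstar_algebra)"
  using scaleC_add_right[of c "0 :: 'a" 0] by simp

lemma scaleC_minus_one: "(-1) *\<^sub>C x = - (x :: 'a::cstar_algebra)"
  using scaleC_of_real[of "-1" x] by simp

lemma adj_zero [simp]: "adj 0 = (0 :: 'a::cstar_algebra)"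
  using adj_add[of "0 :: 'a" 0] by simp

lemma adj_one [simp]: "adj 1 = (1 :: 'a::cstar_algebra)"
  using adj_mult[of "adj 1 :: 'a" 1] by (simp add: adj_adj)

lemma adj_scaleR: "adj (r *\<^sub>R x) = r *\<^sub>R adj (x :: 'a::cstar_algebra)"
  using adj_scaleC[of "complex_of_real r" x] by (simp add: scaleC_of_real)

text \<open>The C*-identity and submultiplicativity give
  \<open>(norm y)\<^sup>2 \<le> norm (adj y) * norm y\<close>; applying this to \<open>x\<close> and
  to \<open>adj x\<close> yields both inequalities.\<close>

lemma norm_adj [simp]: "norm (adj x) = norm (x :: 'a::cstar_algebra)"
proof -
  have *: "norm y \<le> norm (adj y)" for y :: 'a
  proof (cases "norm y = 0")
    case False
    have "norm y * norm y \<le> norm (adj y) * norm y"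
      using cstar_identity[of y] norm_mult_ineq[of "adj y" y] by (simp add: power2_eq_square)
    with False show ?thesis by (simp add: less_le)
  qed auto
  show ?thesis using *[of x] *[of "adj x"] by (simp add: adj_adj)
qed

lemma bounded_linear_adj: "bounded_linear (adj :: 'a::cstar_algebra \<Rightarrow> 'a)"
  by (rule bounded_linear_intro[where K = 1]) (auto simp: adj_add adj_scaleR)

lemma bounded_linear_scaleC: "bounded_linear (\<lambda>x::'a::cstar_algebra. c *\<^sub>C x)"
proof (rule bounded_linear_intro[where K = "cmod c"])
  show "c *\<^sub>C (r *\<^sub>R x) = r *\<^sub>R (c *\<^sub>C x)" for r and x :: 'a
    by (simp add: scaleC_scaleC mult.commute flip: scaleC_of_real)
qed (auto simp: scaleC_add_right norm_scaleC)

lemma continuous_on_adj [continuous_intros]: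
  "continuous_on S f \<Longrightarrow> continuous_on S (\<lambda>x. adj (f x :: 'a::cstar_algebra))"
  by (rule bounded_linear.continuous_on[OF bounded_linear_adj])

text \<open>The root is the binomial series of \<open>(1 - y) powr (1/2)\<close>; it replaces functional calculus.\<close>

lemma selfadjoint_sqrt_exists:
  fixes y :: "'a::cstar_algebra"
  assumes y: "adj y = y" and "norm y < 1"
  obtains b where "adj b = b" "b * b = 1 - y"
proof -
  define c where "c n = ((1/2::real) gchoose n) * (-1) ^ n" for n
  define f where "f n = c n *\<^sub>R y ^ n" for n
  have "ereal (norm (norm y)) < conv_radius (\<lambda>n. (1/2::real) gchoose n)"
    using \<open>norm y < 1\<close> by (auto simp: conv_radius_gchoose)
  from abs_summable_in_conv_radius[OF this]
  have "summable (\<lambda>n. \<bar>c n\<bar> * norm y ^ n)"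
    by (simp add: c_def abs_mult power_abs)
  hence sm: "summable (\<lambda>n. norm (f n))"
    by (rule summable_comparison_test'[where N = 0]) (auto simp: f_def intro!: mult_left_mono norm_power_ineq)
  \<comment> \<open>Vandermonde's identity: squaring the series of exponent 1/2 gives the series of
    exponent 1, whose coefficients vanish from degree 2 on.\<close>
  have half: "(\<Sum>i\<le>n. c i * c (n - i)) = (1 gchoose n) * (-1) ^ n" for n
  proof -
    have "(\<Sum>i\<le>n. c i * c (n - i)) = (\<Sum>i\<le>n. ((1/2) gchoose i) * ((1/2) gchoose (n - i)) * (-1) ^ n)"
      by (rule sum.cong) (auto simp: c_def power_add[symmetric])
    also have "\<dots> = (1 gchoose n) * (-1) ^ n"
      using gbinomial_Vandermonde[of "1/2::real" "1/2" n]
      by (simp add: sum_distrib_right[symmetric] atMost_atLeast0)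
    finally show ?thesis .
  qed
  have coeff: "(\<Sum>i\<le>n. f i * f (n - i)) = ((1 gchoose n) * (-1) ^ n) *\<^sub>R y ^ n" for n
    by (simp add: f_def half[symmetric] scaleR_sum_left power_add[symmetric] mult.commute)
  have "(1 gchoose n :: real) = 0" if "n \<ge> 2" for n
    using that binomial_gbinomial[of 1 n, where ?'a = real] by (simp add: binomial_eq_0)
  hence "(\<lambda>n. ((1 gchoose n) * (-1) ^ n) *\<^sub>R y ^ n) sums (\<Sum>n<2. ((1 gchoose n) * (-1) ^ n) *\<^sub>R y ^ n)"
    by (intro sums_finite) auto
  moreover have "(\<lambda>n. ((1 gchoose n) * (-1) ^ n) *\<^sub>R y ^ n) sums (suminf f * suminf f)"
    using Cauchy_product_sums[OF sm sm] by (simp add: coeff)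
  ultimately have "suminf f * suminf f = 1 - y"
    using sums_unique2 by (fastforce simp: numeral_2_eq_2)
  moreover have "adj (y ^ n) = y ^ n" for n
    by (induction n) (auto simp: adj_mult y power_commutes)
  hence "adj (suminf f) = suminf f"
    using bounded_linear.suminf[OF bounded_linear_adj summable_norm_cancel[OF sm]]
    by (simp add: f_def[abs_def] adj_scaleR)
  ultimately show ?thesis using that by blast
qed

section \<open>Positive functionals: Cauchy-Schwarz and automatic boundedness\<close>

locale positive_functional =
  fixes \<phi> :: "'a::cstar_algebra \<Rightarrow> complex"
  assumes add: "\<phi> (x + y) = \<phi> x + \<phi> y"
    and scale: "\<phi> (c *\<^sub>C x) = c * \<phi> x"
    and pos: "\<phi> (adj x * x) \<in> \<real>\<^sub>\<ge>\<^sub>0"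
begin

lemma zero [simp]: "\<phi> 0 = 0"
  using add[of 0 0] by simp

lemma minus: "\<phi> (- x) = - \<phi> x"
  using scale[of "-1" x] by (simp add: scaleC_minus_one)

lemma diff: "\<phi> (x - y) = \<phi> x - \<phi> y"
  using add[of x "- y"] by (simp add: minus)

lemma sum: "\<phi> (\<Sum>i\<in>I. f i) = (\<Sum>i\<in>I. \<phi> (f i))"
  by (induction I rule: infinite_finite_induct) (auto simp: add)

lemma expand:
  "\<phi> (adj (x + c *\<^sub>C y) * (x + c *\<^sub>C y)) =
    \<phi> (adj x * x) + c * \<phi> (adj x * y) + cnj c * \<phi> (adj y * x) + cnj c * c * \<phi> (adj y * y)"
  by (simp add: adj_add adj_scaleC algebra_simps scaleC_mult_left scaleC_mult_right
      scaleC_scaleC add scale)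

text \<open>The imaginary part of \<open>expand\<close> vanishes for every \<open>c\<close>; the
  values \<open>c = 1\<close> and \<open>c = \<i>\<close> then fix the imaginary and the real
  part.\<close>

lemma hermitian_inner: "\<phi> (adj y * x) = cnj (\<phi> (adj x * y))"
proof -
  have Im0: "Im (\<phi> (adj z * z)) = 0" for z
    using pos[of z] by (simp add: complex_nonneg_Reals_iff)
  have "Im (c * \<phi> (adj x * y) + cnj c * \<phi> (adj y * x)) = 0" for c
    using Im0[of "x + c *\<^sub>C y"] Im0[of x] Im0[of y] unfolding expand
    by simp
  from this[of 1] this[of \<i>] show ?thesis by (auto intro!: complex_eqI)
qed

lemma pos_Re: "Re (\<phi> (adj x * x)) \<ge> 0" and pos_Im: "Im (\<phi> (adj x * x)) = 0"
  using pos[of x] by (auto simp: complex_nonneg_Reals_iff)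

lemma pos_of_real: "\<phi> (adj x * x) = complex_of_real (Re (\<phi> (adj x * x)))"
  using pos_Im[of x] by (simp add: complex_eq_iff)

lemma Cauchy_Schwarz:
  "(cmod (\<phi> (adj x * y)))\<^sup>2 \<le> Re (\<phi> (adj x * x)) * Re (\<phi> (adj y * y))"
proof -
  define a b s where "a = Re (\<phi> (adj x * x))" and "b = Re (\<phi> (adj y * y))" and "s = \<phi> (adj x * y)"
  have quad: "a - 2 * t * (cmod s)\<^sup>2 + t\<^sup>2 * (cmod s)\<^sup>2 * b \<ge> 0" for t :: real
  proof -
    \<comment> \<open>The factor \<open>cnj s\<close> makes both cross terms equal to the real
      number \<open>- t * (cmod s)\<^sup>2\<close>, leaving a real polynomial in
      \<open>t\<close>.\<close>
    define c where "c = - (complex_of_real t * cnj s)"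
    have sq: "cnj z * z = complex_of_real ((cmod z)\<^sup>2)" for z
      using complex_norm_square[of z] by (simp add: mult.commute)
    have 1: "c * s = - complex_of_real (t * (cmod s)\<^sup>2)"
      using sq[of s] by (simp add: c_def mult.assoc)
    have 2: "cnj c * cnj s = - complex_of_real (t * (cmod s)\<^sup>2)"
      using arg_cong[OF 1, of cnj] by simp
    have 3: "cnj c * c = complex_of_real (t\<^sup>2 * (cmod s)\<^sup>2)"
      unfolding sq by (simp add: c_def norm_mult power_mult_distrib)
    have "Re (\<phi> (adj (x + c *\<^sub>C y) * (x + c *\<^sub>C y))) =
      a + Re (c * s) + Re (cnj c * cnj s) + Re (cnj c * c * \<phi> (adj y * y))"
      unfolding expand hermitian_inner[of y x] by (simp add: a_def s_def)
    also have "\<dots> = a - 2 * t * (cmod s)\<^sup>2 + t\<^sup>2 * (cmod s)\<^sup>2 * b"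
      unfolding 1 2 3 by (simp add: b_def)
    finally show ?thesis using pos_Re by metis
  qed
  have b: "b \<ge> 0" and a: "a \<ge> 0" unfolding a_def b_def by (rule pos_Re)+
  have "(cmod s)\<^sup>2 \<le> a * b"
  proof (cases "b = 0")
    case True
    have "(cmod s)\<^sup>2 = 0"
    proof (rule ccontr)
      assume "(cmod s)\<^sup>2 \<noteq> 0"
      \<comment> \<open>For \<open>b = 0\<close> the bound is affine in \<open>t\<close>, and this
        \<open>t\<close> gives it the value -1.\<close>
      thus False using quad[of "(a + 1) / (2 * (cmod s)\<^sup>2)"] True a by (auto simp: field_simps)
    qed
    thus ?thesis using a b by simp
  next
    case False
    thus ?thesis using quad[of "1 / b"] b by (simp add: field_simps power2_eq_square)
  qed
  thus ?thesis by (simp add: a_def b_def s_def)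
qed

lemma Cauchy_Schwarz_null:
  assumes "\<phi> (adj y * y) = 0"
  shows "\<phi> (adj x * y) = 0"
  using Cauchy_Schwarz[of x y] assms by simp

text \<open>Since \<open>1 - adj x * x\<close> is the square of a self-adjoint \<open>b\<close>, the
  difference of the two sides is \<open>\<phi> (adj b * b)\<close>.\<close>

lemma pos_le:
  assumes "norm x < 1"
  shows "Re (\<phi> (adj x * x)) \<le> Re (\<phi> 1)"
proof -
  have "norm (adj x * x) < 1"
    using assms by (simp add: cstar_identity power_less_one_iff)
  then obtain b where b: "adj b = b" "b * b = 1 - adj x * x"
    by (rule selfadjoint_sqrt_exists[rotated]) (auto simp: adj_mult adj_adj)
  have "\<phi> (adj b * b) = \<phi> 1 - \<phi> (adj x * x)"
    by (simp add: b diff)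
  thus ?thesis using pos_Re[of b] by simp
qed

text \<open>To meet the strict bound in \<open>pos_le\<close>, \<open>x\<close> is divided by an
  arbitrary \<open>r > norm x\<close>; Cauchy-Schwarz against the unit then bounds the quotient, and
  \<open>r\<close> decreases to \<open>norm x\<close>.\<close>

lemma norm_le:
  assumes "\<phi> 1 = 1"
  shows "cmod (\<phi> x) \<le> norm x"
proof (rule dense_ge)
  fix r assume r: "norm x < r"
  hence "r > 0" by (rule le_less_trans[OF norm_ge_zero])
  define z where "z = complex_of_real (1 / r) *\<^sub>C x"
  have "norm z < 1" using r \<open>r > 0\<close> by (simp add: z_def norm_scaleC norm_divide)
  hence "(cmod (\<phi> z))\<^sup>2 \<le> 1\<^sup>2"
    using Cauchy_Schwarz[of 1 z] pos_le[of z] by (simp add: assms)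
  hence "cmod (\<phi> z) \<le> 1" by (rule power2_le_imp_le) simp
  thus "cmod (\<phi> x) \<le> r" using \<open>r > 0\<close> by (simp add: z_def scale norm_mult norm_divide field_simps)
qed

lemma scaleR: "\<phi> (r *\<^sub>R x) = r *\<^sub>R \<phi> x"
  using scale[of "complex_of_real r" x] by (simp add: scaleC_of_real scaleR_conv_of_real)

lemma linear: "linear \<phi>"
  by (rule linearI) (auto simp: add scaleR)

end

text \<open>Positivity already forces boundedness, because \<open>1 - x\<^sup>* x\<close> is a square when \<open>\<parallel>x\<parallel> < 1\<close>.\<close>

lemma states_iff: "\<phi> \<in> states \<longleftrightarrow> positive_functional \<phi> \<and> \<phi> 1 = 1"
proof
  assume "positive_functional \<phi> \<and> \<phi> 1 = 1"
  then interpret positive_functional \<phi> by simp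
  have one: "\<phi> 1 = 1" using \<open>positive_functional \<phi> \<and> \<phi> 1 = 1\<close> by simp
  have bl: "bounded_linear \<phi>"
    by (rule bounded_linear_intro[where K = 1]) (auto simp: add scaleR norm_le one)
  have "onorm \<phi> = 1"
  proof (rule antisym)
    show "onorm \<phi> \<le> 1" by (rule onorm_bound) (auto simp: norm_le one)
    show "1 \<le> onorm \<phi>" using onorm[OF bl, of 1] by (simp add: one)
  qed
  thus "\<phi> \<in> states" using bl by (auto simp: states_def scale pos)
next
  assume "\<phi> \<in> states"
  hence bl: "bounded_linear \<phi>" and on: "onorm \<phi> = 1" and sc: "\<And>c x. \<phi> (c *\<^sub>C x) = c * \<phi> x"
    and ps: "\<And>x. \<phi> (adj x * x) \<in> \<real>\<^sub>\<ge>\<^sub>0"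
    by (auto simp: states_def)
  interpret positive_functional \<phi>
    by standard (auto simp: sc ps linear_add[OF bounded_linear.linear[OF bl]])
  have le: "cmod (\<phi> x) \<le> norm x" for x using onorm[OF bl, of x] by (simp add: on)
  have re: "\<phi> 1 = complex_of_real (Re (\<phi> 1))" "Re (\<phi> 1) \<ge> 0"
    using pos_of_real[of 1] pos_Re[of 1] by auto
  \<comment> \<open>Cauchy-Schwarz against the unit brings \<open>\<phi> 1\<close> into the bound;
    as the operator norm is 1, this forces \<open>Re (\<phi> 1)\<close> to be at least 1.\<close>
  have "cmod (\<phi> x) \<le> sqrt (Re (\<phi> 1)) * norm x" for x
  proof -
    have "Re (\<phi> (adj x * x)) \<le> (norm x)\<^sup>2"
      using le[of "adj x * x"] complex_Re_le_cmod[of "\<phi> (adj x * x)"] by (simp add: cstar_identity)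
    hence "(cmod (\<phi> x))\<^sup>2 \<le> Re (\<phi> 1) * (norm x)\<^sup>2"
      using Cauchy_Schwarz[of 1 x] re(2) mult_left_mono[of "Re (\<phi> (adj x * x))" "(norm x)\<^sup>2" "Re (\<phi> 1)"] by simp
    thus ?thesis by (metis real_le_rsqrt real_sqrt_mult real_sqrt_abs abs_norm_cancel)
  qed
  hence "1 \<le> sqrt (Re (\<phi> 1))" using onorm_bound[of "sqrt (Re (\<phi> 1))" \<phi>] on re(2) by simp
  moreover have "Re (\<phi> 1) \<le> 1" using le[of 1] complex_Re_le_cmod[of "\<phi> 1"] by simp
  ultimately have "Re (\<phi> 1) = 1" by simp
  thus "positive_functional \<phi> \<and> \<phi> 1 = 1" using positive_functional_axioms re(1) by simp
qed

lemma state_bounded_linear: "\<phi> \<in> states \<Longrightarrow> bounded_linear \<phi>"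
  by (simp add: states_def)

lemma states_positive: "\<phi> \<in> states \<Longrightarrow> positive_functional \<phi>"
  by (simp add: states_iff)

lemma states_one: "\<phi> \<in> states \<Longrightarrow> \<phi> 1 = 1"
  by (simp add: states_iff)

lemma states_norm_le: "\<phi> \<in> states \<Longrightarrow> cmod (\<phi> x) \<le> norm x"
  by (simp add: states_iff positive_functional.norm_le)

section \<open>Tensor products of states\<close>

locale positive_pair =
  f: positive_functional \<phi> + g: positive_functional \<psi>
  for \<phi> :: "'a::cstar_algebra \<Rightarrow> complex" and \<psi> :: "'b::cstar_algebra \<Rightarrow> complex"
begin

abbreviation gns where "gns \<equiv> gns_inner \<phi> \<psi>"

lemma gns_Nil [simp]: "gns [] ys = 0" "gns xs [] = 0"
  by (auto simp: gns_inner_def case_prod_unfold)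

lemma gns_Cons_left:
  "gns ((a, b) # xs) ys = (\<Sum>(c, d)\<leftarrow>ys. \<phi> (adj a * c) * \<psi> (adj b * d)) + gns xs ys"
  by (simp add: gns_inner_def)

lemma gns_Cons_right:
  "gns xs ((c, d) # ys) = (\<Sum>(a, b)\<leftarrow>xs. \<phi> (adj a * c) * \<psi> (adj b * d)) + gns xs ys"
  by (induction xs) (auto simp: gns_Cons_left)

lemma gns_append_left: "gns (xs @ xs') ys = gns xs ys + gns xs' ys"
  by (simp add: gns_inner_def)

lemma gns_append_right: "gns xs (ys @ ys') = gns xs ys + gns xs ys'"
  by (induction ys) (auto simp: gns_Cons_right)

lemma gns_hermitian: "gns ys xs = cnj (gns xs ys)"
proof (induction xs)
  case (Cons x xs)
  obtain a b where x: "x = (a, b)" by force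
  have "(\<Sum>(c, d)\<leftarrow>ys. \<phi> (adj c * a) * \<psi> (adj d * b)) =
    cnj (\<Sum>(c, d)\<leftarrow>ys. \<phi> (adj a * c) * \<psi> (adj b * d))"
  proof (induction ys)
    case (Cons y ys)
    thus ?case using f.hermitian_inner[of "fst y" a] g.hermitian_inner[of "snd y" b]
      by (simp add: case_prod_unfold)
  qed simp
  with Cons show ?case by (simp add: x gns_Cons_left gns_Cons_right)
qed simp

text \<open>Gram--Schmidt in the second factor: splitting off the component along the first \<open>b\<close> turns
  the form into a sum of a product of squares and a form in one variable less. If \<open>b\<close> is a null
  vector, then \<open>t = 0\<close> by the convention \<open>x / 0 = 0\<close>, and the argument still works.\<close>

lemma gns_nonneg: "gns xs xs \<in> \<real>\<^sub>\<ge>\<^sub>0"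
proof (induction xs rule: length_induct)
  case (1 xs)
  show ?case
  proof (cases xs)
    case (Cons x r)
    obtain a b where x: "x = (a, b)" by force
    define t where "t d = \<psi> (adj b * d) / \<psi> (adj b * b)" for d
    define a' where "a' = a + (\<Sum>(c, d)\<leftarrow>r. t d *\<^sub>C c)"
    define r' where "r' = map (\<lambda>(c, d). (c, d - t d *\<^sub>C b)) r"
    define zs where "zs = (a', b) # r'"
    have one: "(\<Sum>(c, d)\<leftarrow>r. \<phi> (p * c) * \<psi> (q * d)) =
        \<phi> (p * (\<Sum>(c, d)\<leftarrow>r. t d *\<^sub>C c)) * \<psi> (q * b) + (\<Sum>(c, d)\<leftarrow>r'. \<phi> (p * c) * \<psi> (q * d))" for p q
      unfolding r'_def
      by (induction r) (auto simp: algebra_simps f.add f.scale g.diff g.scale scaleC_mult_right)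
    \<comment> \<open>Both lists represent the same vector. Different lists can do so, hence
      equality is tested by pairing with every \<open>ys\<close>.\<close>
    have subst: "gns ys xs = gns ys zs" for ys
    proof (induction ys)
      case (Cons y ys)
      obtain p q where "y = (p, q)" by force
      with Cons one[of "adj p" "adj q"] show ?case
        by (simp add: gns_Cons_left \<open>xs = x # r\<close> x zs_def a'_def algebra_simps f.add)
    qed simp
    have "gns xs xs = cnj (gns zs xs)" using subst gns_hermitian by metis
    also have "\<dots> = gns zs zs" unfolding subst by (rule gns_hermitian[symmetric])
    also have "\<dots> = \<phi> (adj a' * a') * \<psi> (adj b * b) + gns r' r'"
    proof -
      \<comment> \<open>The remainders are orthogonal to \<open>b\<close>, so the cross terms
        between \<open>(a', b)\<close> and \<open>r'\<close> drop out.\<close>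
      have "\<psi> (adj b * (d - t d *\<^sub>C b)) = 0" for d
        using g.Cauchy_Schwarz_null[of b d]
          g.Cauchy_Schwarz[of b d]
        by (cases "\<psi> (adj b * b) = 0")
          (auto simp: t_def algebra_simps g.diff g.scale scaleC_mult_right)
      hence 0: "(\<Sum>(c, d)\<leftarrow>r'. \<phi> (adj a' * c) * \<psi> (adj b * d)) = 0"
        unfolding r'_def by (induction r) auto
      have "gns r' zs = cnj (gns zs r')" by (rule gns_hermitian)
      also have "gns zs r' = gns r' r'" by (simp add: zs_def gns_Cons_left 0)
      finally have "gns r' zs = gns r' r'" using gns_hermitian[of r' r'] by simp
      thus ?thesis by (simp add: zs_def gns_Cons_left 0)
    qed
    also have "\<dots> \<in> \<real>\<^sub>\<ge>\<^sub>0"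
      using 1 by (intro nonneg_Reals_add_I nonneg_Reals_mult_I f.pos g.pos) (auto simp: r'_def Cons)
    finally show ?thesis .
  qed simp
qed

text \<open>Cauchy-Schwarz against the unit vector \<open>1 \<otimes> 1\<close>: the list
  \<open>xs @ e\<close> encodes the vector of \<open>xs\<close> minus its component \<open>s\<close>
  along \<open>1 \<otimes> 1\<close>, and its squared length is \<open>gns xs xs\<close> minus
  \<open>(cmod s)\<^sup>2\<close>.\<close>

lemma tensor_functional_le_gns:
  assumes "\<phi> 1 = 1" "\<psi> 1 = 1"
  shows "(cmod (\<Sum>(a, b)\<leftarrow>xs. \<phi> a * \<psi> b))\<^sup>2 \<le> Re (gns xs xs)"
proof -
  define s where "s = (\<Sum>(a, b)\<leftarrow>xs. \<phi> a * \<psi> b)"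
  define e where "e = [(- s *\<^sub>C (1 :: 'a), 1 :: 'b)]"
  have 1: "gns e xs = - cnj s * s"
  proof -
    have "gns [(c *\<^sub>C 1, 1)] ys = cnj c * (\<Sum>(a, b)\<leftarrow>ys. \<phi> a * \<psi> b)" for c ys
      by (induction ys) (auto simp: gns_Cons_right adj_scaleC scaleC_mult_left f.scale algebra_simps)
    thus ?thesis by (simp add: e_def s_def)
  qed
  have 2: "gns xs e = - (cnj s * s)"
    by (subst gns_hermitian) (simp add: 1)
  have 3: "gns e e = cnj s * s"
    by (simp add: e_def gns_Cons_left adj_scaleC scaleC_mult_left scaleC_mult_right f.scale assms)
  have "gns (xs @ e) (xs @ e) = gns xs xs - cnj s * s"
    by (simp add: gns_append_left gns_append_right 1 2 3)
  also have "cnj s * s = complex_of_real ((cmod s)\<^sup>2)"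
    using complex_norm_square[of s] by (simp add: mult.commute)
  finally have "Re (gns (xs @ e) (xs @ e)) = Re (gns xs xs) - (cmod s)\<^sup>2" by simp
  moreover have "Re (gns (xs @ e) (xs @ e)) \<ge> 0"
    using gns_nonneg[of "xs @ e"] by (simp add: complex_nonneg_Reals_iff)
  ultimately show ?thesis by (simp add: s_def)
qed

end

text \<open>The bound makes \<open>f\<close> 1-Lipschitz on \<open>V\<close>, so it extends
  continuously to the closure. Linearity and the bound are closed conditions and pass from the dense
  subspace to the whole space.\<close>

lemma bounded_linear_extension:
  fixes f :: "'a::real_normed_vector \<Rightarrow> 'b::banach"
  assumes V: "subspace V" "closure V = UNIV"
    and add: "\<And>x y. x \<in> V \<Longrightarrow> y \<in> V \<Longrightarrow> f (x + y) = f x + f y"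
    and scale: "\<And>r x. x \<in> V \<Longrightarrow> f (r *\<^sub>R x) = r *\<^sub>R f x"
    and bound: "\<And>x. x \<in> V \<Longrightarrow> norm (f x) \<le> norm x"
  obtains F where "bounded_linear F" "\<And>x. x \<in> V \<Longrightarrow> F x = f x"
proof -
  have diff: "f (x - y) = f x - f y" if "x \<in> V" "y \<in> V" for x y
    using add[of x "(-1) *\<^sub>R y"] scale[of y "-1"] subspace_scale[OF V(1), of y "-1"] that by simp
  have "1-lipschitz_on V f"
    using bound subspace_diff[OF V(1)] by (auto simp: lipschitz_on_def dist_norm diff[symmetric])
  then obtain F where uc: "uniformly_continuous_on (closure V) F" and F: "\<And>x. x \<in> V \<Longrightarrow> f x = F x"
    using uniformly_continuous_on_extension_on_closure[OF lipschitz_on_uniformly_continuous] by metis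
  have F_cont: "continuous_on UNIV F"
    using uniformly_continuous_imp_continuous[OF uc] V(2) by simp
  note cont = continuous_on_compose2[OF F_cont, simplified]
  have dense: "P x" if "closed {x. P x}" "\<And>x. x \<in> V \<Longrightarrow> P x" for P x
    using closure_minimal[of V "{x. P x}"] that V(2) by auto
  have "F (x + y) = F x + F y" for x y
  proof (rule dense[where P = "\<lambda>y. F (x + y) = F x + F y"])
    fix y assume y: "y \<in> V"
    show "F (x + y) = F x + F y"
    proof (rule dense[where P = "\<lambda>x. F (x + y) = F x + F y"])
      show "F (x + y) = F x + F y" if "x \<in> V" for x
        using add[OF that y] F[OF that] F[OF y] F[OF subspace_add[OF V(1) that y]] by simp
    qed (intro closed_Collect_eq continuous_intros cont)
  qed (intro closed_Collect_eq continuous_intros cont)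
  moreover have "F (r *\<^sub>R x) = r *\<^sub>R F x" for r x
    by (rule dense[where P = "\<lambda>x. F (r *\<^sub>R x) = r *\<^sub>R F x"])
      (use scale F subspace_scale[OF V(1)] in \<open>auto intro!: closed_Collect_eq continuous_intros cont\<close>)
  moreover have "norm (F x) \<le> norm x * 1" for x
    by (rule dense[where P = "\<lambda>x. norm (F x) \<le> norm x * 1"])
      (use bound F in \<open>auto intro!: closed_Collect_le continuous_intros cont\<close>)
  ultimately have "bounded_linear F" by (intro bounded_linear_intro)
  with F show ?thesis using that by metis
qed

section \<open>Product states on the minimal tensor product\<close>

context min_tensor
begin

abbreviation tsum where "tsum \<equiv> tensor_sum tens"

lemma tsum_append: "tsum (xs @ ys) = tsum xs + tsum ys"
  by (simp add: tensor_sum_def)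

lemma tensor_sum_scaleC: "tsum (map (\<lambda>(a, b). (c *\<^sub>C a, b)) xs) = c *\<^sub>C tsum xs"
  by (induction xs) (auto simp: tensor_sum_def tensor_scale_left scaleC_add_right)

lemma tensor_sum_scaleR: "tsum (map (\<lambda>(a, b). (r *\<^sub>R a, b)) xs) = r *\<^sub>R tsum xs"
  using tensor_sum_scaleC[of "complex_of_real r" xs] by (simp add: scaleC_of_real)

lemma subspace_tensor_sums: "subspace (range tsum)"
proof (rule subspaceI)
  show "0 \<in> range tsum" by (rule range_eqI[of _ _ "[]"]) (simp add: tensor_sum_def)
  show "x + y \<in> range tsum" if "x \<in> range tsum" "y \<in> range tsum" for x y
    using that by (auto simp flip: tsum_append)
  show "r *\<^sub>R x \<in> range tsum" if "x \<in> range tsum" for r x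
    using that by (auto simp flip: tensor_sum_scaleR)
qed

lemma closure_tensor_sums: "closure (range tsum) = UNIV"
proof -
  have "tens a b \<in> range tsum" for a b
    by (rule range_eqI[of _ _ "[(a, b)]"]) (simp add: tensor_sum_def)
  hence "span {tens a b | a b. True} \<subseteq> range tsum"
    by (intro span_minimal subspace_tensor_sums) auto
  from closure_mono[OF this] show ?thesis using dense_tensors by auto
qed

lemma dense_induct:
  assumes "closed {z. P z}" "\<And>xs. P (tsum xs)"
  shows "P z"
  using closure_minimal[of "range tsum" "{z. P z}"] assms closure_tensor_sums by auto

text \<open>The bound by the spatial norm is \<open>spatial_bound\<close> tested on the cyclic vector \<open>1 \<otimes> 1\<close>.\<close>

lemma tensor_functional_le_norm:
  assumes "\<phi> \<in> states" "\<psi> \<in> states"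
  shows "cmod (\<Sum>(a, b)\<leftarrow>xs. \<phi> a * \<psi> b) \<le> norm (tsum xs)"
proof -
  interpret positive_pair \<phi> \<psi>
    using assms by (simp add: positive_pair_def states_positive)
  have "tensor_mult xs [(1, 1)] = xs"
    by (induction xs) (auto simp: tensor_mult_def)
  hence "Re (gns xs xs) \<le> (norm (tsum xs))\<^sup>2 * Re (gns [(1, 1)] [(1, 1)])"
    using norm_tensor[of xs] assms unfolding is_spatial_norm_def spatial_bound_def by metis
  also have "gns [(1, 1)] [(1, 1)] = 1"
    by (simp add: gns_inner_def states_one assms)
  finally have "Re (gns xs xs) \<le> (norm (tsum xs))\<^sup>2" by simp
  with tensor_functional_le_gns[OF states_one[OF assms(1)] states_one[OF assms(2)], of xs]
  have "(cmod (\<Sum>(a, b)\<leftarrow>xs. \<phi> a * \<psi> b))\<^sup>2 \<le> (norm (tsum xs))\<^sup>2"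
    by (rule order_trans)
  thus ?thesis by (rule power2_le_imp_le) simp
qed

lemma bounded_linear_eqI:
  assumes "bounded_linear F" "bounded_linear G" "\<And>a b. F (tens a b) = G (tens a b)"
  shows "F = G"
proof
  fix z
  interpret F: bounded_linear F by fact
  interpret G: bounded_linear G by fact
  show "F z = G z"
  proof (rule dense_induct)
    show "F (tsum xs) = G (tsum xs)" for xs
      by (induction xs) (auto simp: tensor_sum_def F.zero G.zero F.add G.add assms(3))
  qed (intro closed_Collect_eq F.continuous_on G.continuous_on continuous_intros)
qed

text \<open>\<open>tensor_ext\<close> is a definite description, so its properties require existence
  and uniqueness of the map. Existence comes from the spatial bound, which makes the functional well
  defined and contractive on finite tensor sums; uniqueness comes from density.\<close>

lemma tensor_ext_states:
  assumes "\<phi> \<in> states" "\<psi> \<in> states"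
  defines "F \<equiv> tensor_ext tens (\<lambda>a b. \<phi> a * \<psi> b)"
  shows "bounded_linear F" "F (tens a b) = \<phi> a * \<psi> b"
proof -
  define s where "s xs = (\<Sum>(a, b)\<leftarrow>xs. \<phi> a * \<psi> b)" for xs
  interpret positive_pair \<phi> \<psi>
    using assms by (simp add: positive_pair_def states_positive)
  have s_append: "s (xs @ ys) = s xs + s ys" for xs ys
    by (simp add: s_def)
  have s_scale: "s (map (\<lambda>(a, b). (r *\<^sub>R a, b)) xs) = r *\<^sub>R s xs" for r xs
    by (induction xs) (auto simp: s_def f.scaleR algebra_simps)
  have s_le: "cmod (s xs) \<le> norm (tsum xs)" for xs
    unfolding s_def by (rule tensor_functional_le_norm) fact+
  \<comment> \<open>The list joining \<open>xs\<close> with the negative of \<open>ys\<close>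
    represents 0, so \<open>s_le\<close> makes \<open>s\<close> vanish on it.\<close>
  have s_cong: "s xs = s ys" if "tsum xs = tsum ys" for xs ys
    using s_le[of "xs @ map (\<lambda>(a, b). ((-1) *\<^sub>R a, b)) ys"] that
    by (simp only: s_append s_scale tsum_append tensor_sum_scaleR) simp
  define G where "G z = s (SOME xs. tsum xs = z)" for z
  have G: "G (tsum xs) = s xs" for xs
    unfolding G_def by (rule s_cong) (rule someI[of _ xs], simp)
  obtain H where H: "bounded_linear H" "\<And>z. z \<in> range tsum \<Longrightarrow> H z = G z"
  proof (rule bounded_linear_extension[OF subspace_tensor_sums closure_tensor_sums, of G])
    show "G (x + y) = G x + G y" if "x \<in> range tsum" "y \<in> range tsum" for x y
      using that by (auto simp: G tsum_append[symmetric] s_append)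
    show "G (r *\<^sub>R x) = r *\<^sub>R G x" if "x \<in> range tsum" for r x
      using that by (auto simp: G tensor_sum_scaleR[symmetric] s_scale)
    show "norm (G x) \<le> norm x" if "x \<in> range tsum" for x
      using that by (auto simp: G s_le)
  qed blast
  have H_tens: "H (tens a b) = \<phi> a * \<psi> b" for a b
    using H(2)[of "tsum [(a, b)]"] by (simp add: G) (simp add: tensor_sum_def s_def)
  have "F = H"
    unfolding F_def tensor_ext_def
    by (rule the_equality) (use H(1) H_tens in \<open>auto intro: bounded_linear_eqI\<close>)
  thus "bounded_linear F" "F (tens a b) = \<phi> a * \<psi> b"
    using H(1) H_tens by auto
qed

text \<open>On a finite tensor sum \<open>z\<close> the value at \<open>adj z * z\<close> is the
  form \<open>gns\<close>, which is nonnegative; density and continuity do the rest.\<close>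

lemma tensor_ext_state:
  assumes "\<phi> \<in> states" "\<psi> \<in> states"
  shows "tensor_ext tens (\<lambda>a b. \<phi> a * \<psi> b) \<in> states"
proof -
  define F where "F = tensor_ext tens (\<lambda>a b. \<phi> a * \<psi> b)"
  interpret positive_pair \<phi> \<psi>
    using assms by (simp add: positive_pair_def states_positive)
  interpret F: bounded_linear F
    unfolding F_def by (rule tensor_ext_states) fact+
  have F_tens: "F (tens a b) = \<phi> a * \<psi> b" for a b
    unfolding F_def by (rule tensor_ext_states) fact+
  have F_tsum: "F (tsum xs) = (\<Sum>(a, b)\<leftarrow>xs. \<phi> a * \<psi> b)" for xs
    by (induction xs) (auto simp: tensor_sum_def F.zero F.add F_tens)
  have mult: "F (adj (tsum xs) * tsum ys) = gns xs ys" for xs ys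
  proof (induction xs)
    case (Cons x xs)
    obtain a b where x: "x = (a, b)" by force
    have "F (adj (tens a b) * tsum ys) = (\<Sum>(c, d)\<leftarrow>ys. \<phi> (adj a * c) * \<psi> (adj b * d))"
      by (induction ys)
        (auto simp: tensor_sum_def F.zero F.add F_tens distrib_left tensor_adj tensor_times)
    with Cons show ?case
      by (simp add: x gns_Cons_left) (simp add: tensor_sum_def adj_add distrib_right F.add)
  qed (simp add: tensor_sum_def F.zero)
  have "F (adj z * z) \<in> \<real>\<^sub>\<ge>\<^sub>0" for z
  proof (rule dense_induct[where P = "\<lambda>z. F (adj z * z) \<in> \<real>\<^sub>\<ge>\<^sub>0"])
    have "{z. F (adj z * z) \<in> \<real>\<^sub>\<ge>\<^sub>0} = (\<lambda>z. F (adj z * z)) -` \<real>\<^sub>\<ge>\<^sub>0" by auto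
    also have "closed \<dots>"
      by (intro continuous_closed_vimage closed_nonneg_Reals_complex F.isCont
          bounded_linear.isCont[OF bounded_linear_adj] continuous_intros)
    finally show "closed {z. F (adj z * z) \<in> \<real>\<^sub>\<ge>\<^sub>0}" .
  qed (simp add: mult gns_nonneg)
  moreover have "F (c *\<^sub>C z) = c * F z" for c z
  proof (rule dense_induct)
    show "F (c *\<^sub>C tsum xs) = c * F (tsum xs)" for xs
      unfolding tensor_sum_scaleC[symmetric] F_tsum
      by (induction xs) (auto simp: f.scale algebra_simps)
  qed (intro closed_Collect_eq F.continuous_on continuous_intros
      bounded_linear.continuous_on[OF bounded_linear_scaleC])
  moreover have "F 1 = 1"
    using F_tens[of 1 1] by (simp add: tensor_one states_one assms)
  ultimately show ?thesis
    unfolding F_def[symmetric] states_iff positive_functional_def by (simp add: F.add)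
qed

end

section \<open>Finite contractions\<close>

definition contraction_on :: "'i set \<Rightarrow> ('i \<Rightarrow> 'i \<Rightarrow> complex) \<Rightarrow> bool" where
  "contraction_on X W \<longleftrightarrow>
     (\<forall>\<xi>. (\<Sum>i\<in>X. (cmod (\<Sum>j\<in>X. W i j * \<xi> j))\<^sup>2) \<le> (\<Sum>j\<in>X. (cmod (\<xi> j))\<^sup>2))"

lemma sum_norm_diff_square:
  fixes a b :: "'i \<Rightarrow> complex"
  shows "(\<Sum>i\<in>X. (cmod (a i - b i))\<^sup>2) =
    (\<Sum>i\<in>X. (cmod (a i))\<^sup>2) - 2 * Re (\<Sum>i\<in>X. cnj (a i) * b i) + (\<Sum>i\<in>X. (cmod (b i))\<^sup>2)"
proof -
  have "(cmod (x - y))\<^sup>2 = (cmod x)\<^sup>2 - 2 * Re (cnj x * y) + (cmod y)\<^sup>2" for x y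
    unfolding cmod_power2 by (simp add: power2_eq_square algebra_simps)
  thus ?thesis by (simp add: sum.distrib sum_subtractf sum_distrib_left)
qed

lemma sum_cnj_mult_self: "Re (\<Sum>i\<in>X. cnj (a i) * a i) = (\<Sum>i\<in>X. (cmod (a i))\<^sup>2)"
  unfolding cmod_power2 by (simp add: power2_eq_square)

lemma sum_norm_diff_square_le_0D:
  fixes a b :: "'i \<Rightarrow> complex"
  assumes "finite X" "(\<Sum>i\<in>X. (cmod (a i - b i))\<^sup>2) \<le> 0" "i \<in> X"
  shows "a i = b i"
proof -
  have "(\<Sum>i\<in>X. (cmod (a i - b i))\<^sup>2) = 0"
    using assms(2) by (intro antisym sum_nonneg) auto
  thus ?thesis using assms(1,3) by (auto simp: sum_nonneg_eq_0_iff)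
qed

text \<open>Let \<open>\<zeta>\<close> be the image of \<open>\<xi>\<close> under the adjoint. Its
  inner product with \<open>\<xi>\<close> is the squared norm of \<open>\<xi>\<close>, and its norm
  is at most that of \<open>\<xi>\<close>; this is the equality case of Cauchy-Schwarz, so
  \<open>\<zeta> = \<xi>\<close> on \<open>X\<close>.\<close>

lemma contraction_fixed_adjoint:
  assumes "finite X" and W: "contraction_on X W"
    and fixed: "\<And>i. i \<in> X \<Longrightarrow> (\<Sum>j\<in>X. W i j * \<xi> j) = \<xi> i"
    and "j \<in> X"
  shows "(\<Sum>i\<in>X. cnj (W i j) * \<xi> i) = \<xi> j"
proof -
  define \<zeta> where "\<zeta> j = (\<Sum>i\<in>X. cnj (W i j) * \<xi> i)" for j
  define \<eta> where "\<eta> i = (\<Sum>j\<in>X. W i j * \<zeta> j)" for i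
  have adjoint: "(\<Sum>j\<in>X. cnj (\<zeta> j) * v j) = (\<Sum>i\<in>X. cnj (\<xi> i) * (\<Sum>j\<in>X. W i j * v j))" for v
    unfolding \<zeta>_def by (simp add: sum_distrib_left sum_distrib_right mult_ac) (rule sum.swap)
  have 1: "(\<Sum>j\<in>X. (cmod (\<zeta> j))\<^sup>2) = Re (\<Sum>i\<in>X. cnj (\<xi> i) * \<eta> i)"
    using adjoint[of \<zeta>] sum_cnj_mult_self[of \<zeta> X] by (simp add: \<eta>_def)
  have 2: "(\<Sum>j\<in>X. cnj (\<zeta> j) * \<xi> j) = (\<Sum>i\<in>X. cnj (\<xi> i) * \<xi> i)"
    using adjoint[of \<xi>] by (simp add: fixed)
  have 3: "(\<Sum>i\<in>X. (cmod (\<eta> i))\<^sup>2) \<le> (\<Sum>j\<in>X. (cmod (\<zeta> j))\<^sup>2)"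
    using W unfolding contraction_on_def \<eta>_def by blast
  \<comment> \<open>Expanding this square with \<open>1\<close> and \<open>3\<close> bounds the norm
    of \<open>\<zeta>\<close> by that of \<open>\<xi>\<close>: contractivity of the adjoint at
    \<open>\<xi>\<close>.\<close>
  have "0 \<le> (\<Sum>i\<in>X. (cmod (\<xi> i - \<eta> i))\<^sup>2)" by (intro sum_nonneg) auto
  with 1 3 have "(\<Sum>j\<in>X. (cmod (\<zeta> j))\<^sup>2) \<le> (\<Sum>i\<in>X. (cmod (\<xi> i))\<^sup>2)"
    unfolding sum_norm_diff_square by linarith
  hence "(\<Sum>j\<in>X. (cmod (\<zeta> j - \<xi> j))\<^sup>2) \<le> 0"
    unfolding sum_norm_diff_square 2 sum_cnj_mult_self by linarith
  with assms show ?thesis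
    using sum_norm_diff_square_le_0D[of X \<zeta> \<xi> j] by (simp add: \<zeta>_def)
qed

text \<open>Strict convexity of the norm, in the form of the parallelogram law.\<close>

lemma contraction_average_fixed:
  assumes "finite X" and V: "contraction_on X V" and W: "contraction_on X W"
    and fixed: "\<And>i. i \<in> X \<Longrightarrow> (\<Sum>j\<in>X. (V i j + W i j) / 2 * \<xi> j) = \<xi> i"
    and "i \<in> X"
  shows "(\<Sum>j\<in>X. V i j * \<xi> j) = \<xi> i"
proof -
  define a b where "a i = (\<Sum>j\<in>X. V i j * \<xi> j)" and "b i = (\<Sum>j\<in>X. W i j * \<xi> j)" for i
  have b: "b i = 2 * \<xi> i - a i" if "i \<in> X" for i
  proof -
    have "(\<Sum>j\<in>X. (V i j + W i j) / 2 * \<xi> j) = (a i + b i) / 2"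
      by (simp add: a_def b_def sum.distrib sum_divide_distrib[symmetric] algebra_simps add_divide_distrib)
    with fixed[OF that] show ?thesis by (simp add: field_simps)
  qed
  have le: "(\<Sum>i\<in>X. (cmod (a i))\<^sup>2) \<le> (\<Sum>i\<in>X. (cmod (\<xi> i))\<^sup>2)"
    "(\<Sum>i\<in>X. (cmod (b i))\<^sup>2) \<le> (\<Sum>i\<in>X. (cmod (\<xi> i))\<^sup>2)"
    using V W unfolding contraction_on_def a_def b_def by blast+
  have "(cmod x)\<^sup>2 + (cmod (2 * y - x))\<^sup>2 = 2 * (cmod y)\<^sup>2 + 2 * (cmod (x - y))\<^sup>2" for x y
    unfolding cmod_power2 by (simp add: power2_eq_square algebra_simps)
  hence "(\<Sum>i\<in>X. (cmod (a i))\<^sup>2) + (\<Sum>i\<in>X. (cmod (b i))\<^sup>2) =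
      2 * (\<Sum>i\<in>X. (cmod (\<xi> i))\<^sup>2) + 2 * (\<Sum>i\<in>X. (cmod (a i - \<xi> i))\<^sup>2)"
    by (simp add: b sum.distrib[symmetric] sum_distrib_left)
  with le have "(\<Sum>i\<in>X. (cmod (a i - \<xi> i))\<^sup>2) \<le> 0" by linarith
  with assms show ?thesis
    using sum_norm_diff_square_le_0D[of X a \<xi> i] by (simp add: a_def)
qed

section \<open>Compactness of the state space\<close>

text \<open>Tychonoff's theorem, as in Banach-Alaoglu: the set is a product of closed discs, and
  functions carry the product topology, that is, pointwise convergence.\<close>

lemma compact_cball_functions:
  "compact {f :: 'a::real_normed_vector \<Rightarrow> complex. \<forall>x. cmod (f x) \<le> norm x}"
proof -
  have "compactin (product_topology (\<lambda>_. euclidean) UNIV)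
      (PiE UNIV (\<lambda>x :: 'a. cball (0 :: complex) (norm x)))"
    unfolding compactin_PiE by simp
  moreover have "PiE UNIV (\<lambda>x :: 'a. cball (0 :: complex) (norm x)) = {f. \<forall>x. cmod (f x) \<le> norm x}"
    by auto
  ultimately show ?thesis by (simp add: euclidean_product_topology)
qed

lemma continuous_eval: "continuous_on S (\<lambda>f. (f :: 'a \<Rightarrow> 'b::topological_space) x)"
  by (rule continuous_on_product_then_coordinatewise) (rule continuous_on_id)

lemma closed_eval_vimage: "closed S \<Longrightarrow> closed {f :: 'a \<Rightarrow> 'b::topological_space. f x \<in> S}"
  using closed_vimage[OF _ continuous_eval] by (simp add: vimage_def)

text \<open>In the form \<open>states_iff\<close> every condition involves finitely many point
  evaluations, unlike the operator norm in the definition.\<close>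

lemma closed_states: "closed (states :: ('a::cstar_algebra \<Rightarrow> complex) set)"
proof -
  have "states = {\<phi> :: 'a \<Rightarrow> complex. (\<forall>x y. \<phi> (x + y) = \<phi> x + \<phi> y) \<and>
      (\<forall>c x. \<phi> (c *\<^sub>C x) = c * \<phi> x) \<and> (\<forall>x. \<phi> (adj x * x) \<in> \<real>\<^sub>\<ge>\<^sub>0) \<and> \<phi> 1 = 1}"
    by (auto simp: states_iff positive_functional_def)
  also have "closed \<dots>"
    by (intro closed_Collect_conj closed_Collect_all closed_Collect_eq closed_eval_vimage
        closed_nonneg_Reals_complex continuous_eval continuous_intros)
  finally show ?thesis .
qed

lemma compact_states: "compact (states :: ('a::cstar_algebra \<Rightarrow> complex) set)"
proof -
  have "states = {f :: 'a \<Rightarrow> complex. \<forall>x. cmod (f x) \<le> norm x} \<inter> states"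
    using states_norm_le by blast
  thus ?thesis using compact_Int_closed[OF compact_cball_functions closed_states] by metis
qed

lemma average_states:
  assumes "0 < m" "\<And>k. k < m \<Longrightarrow> \<phi> k \<in> states"
  shows "(\<lambda>x. (\<Sum>k<m. \<phi> k x) / of_nat m) \<in> states"
  unfolding states_iff
proof (intro conjI positive_functional.intro)
  have pf: "positive_functional (\<phi> k)" if "k < m" for k
    using assms(2)[OF that] by (rule states_positive)
  show "(\<Sum>k<m. \<phi> k (x + y)) / of_nat m = (\<Sum>k<m. \<phi> k x) / of_nat m + (\<Sum>k<m. \<phi> k y) / of_nat m" for x y
    by (simp add: positive_functional.add[OF pf] sum.distrib add_divide_distrib)
  show "(\<Sum>k<m. \<phi> k (c *\<^sub>C x)) / of_nat m = c * ((\<Sum>k<m. \<phi> k x) / of_nat m)" for c x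
    by (simp add: positive_functional.scale[OF pf] sum_distrib_left)
  show "(\<Sum>k<m. \<phi> k (adj x * x)) / of_nat m \<in> \<real>\<^sub>\<ge>\<^sub>0" for x
  proof (intro nonneg_Reals_divide_I)
    show "(\<Sum>k<m. \<phi> k (adj x * x)) \<in> \<real>\<^sub>\<ge>\<^sub>0"
      using positive_functional.pos[OF pf] by (auto simp: complex_nonneg_Reals_iff intro!: sum_nonneg sum.neutral)
  qed auto
  show "(\<Sum>k<m. \<phi> k 1) / of_nat m = 1"
    using assms by (simp add: states_one)
qed

section \<open>Tensor powers of the fundamental representation\<close>

lemma span_mult_closed:
  fixes S :: "'a::real_algebra set"
  assumes S: "\<And>x y. x \<in> S \<Longrightarrow> y \<in> S \<Longrightarrow> x * y \<in> S"
    and "x \<in> span S" "y \<in> span S"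
  shows "x * y \<in> span S"
proof -
  have 1: "x * y \<in> span S" if "y \<in> S" "x \<in> span S" for x y
    using that(2)
  proof (induction rule: span_induct)
    case base
    show ?case
      by (rule subspaceI) (auto simp: span_zero distrib_right intro: span_add span_scale)
  next
    case (step x)
    thus ?case using S that(1) by (intro span_base)
  qed
  show ?thesis using assms(3)
  proof (induction rule: span_induct)
    case base
    show ?case
      by (rule subspaceI) (auto simp: span_zero distrib_left intro: span_add span_scale)
  next
    case (step y)
    thus ?case using 1 assms(2) by blast
  qed
qed

lemma span_linear_image_closed:
  assumes "linear f" "\<And>x. x \<in> S \<Longrightarrow> f x \<in> span S" "x \<in> span S"
  shows "f x \<in> span S"
  using assms(3)
proof (induction rule: span_induct)
  case base
  show ?case
    using assms(1)
    by (intro subspaceI) (auto simp: linear_0 linear_add linear_scale span_zero intro: span_add span_scale)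
qed (use assms(2) in auto)

context quantum_permutation_group
begin

abbreviation H :: "'a set" where "H \<equiv> coefficient_algebra N u"

abbreviation conv :: "('a \<Rightarrow> complex) \<Rightarrow> ('a \<Rightarrow> complex) \<Rightarrow> 'a \<Rightarrow> complex" where
  "conv \<equiv> convolution tens \<Delta>"

text \<open>Indices of the standard basis of the \<open>n\<close>-th tensor power of the
  \<open>N\<close>-dimensional space.\<close>

definition words :: "nat \<Rightarrow> nat list set" where
  "words n = {I. set I \<subseteq> {1..N} \<and> length I = n}"

text \<open>The entry in row \<open>I\<close> and column \<open>J\<close> of the tensor power of \<open>u\<close> whose exponent is the common
  length of \<open>I\<close> and \<open>J\<close>.\<close>

definition entry :: "nat list \<Rightarrow> nat list \<Rightarrow> 'a" where
  "entry I J = prod_list (map2 u I J)"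

lemma finite_words [simp]: "finite (words n)"
  unfolding words_def by (rule finite_lists_length_eq) simp

lemma words_0 [simp]: "words 0 = {[]}"
  by (auto simp: words_def)

lemma words_Suc: "words (Suc n) = (\<lambda>(i, I). i # I) ` ({1..N} \<times> words n)"
  by (auto simp: words_def length_Suc_conv image_iff)

lemma Cons_in_words_iff [simp]: "i # I \<in> words (Suc n) \<longleftrightarrow> i \<in> {1..N} \<and> I \<in> words n"
  by (auto simp: words_def)

lemma words_length: "I \<in> words n \<Longrightarrow> length I = n"
  by (simp add: words_def)

lemma sum_words_Suc: "(\<Sum>K\<in>words (Suc n). f K) = (\<Sum>k=1..N. \<Sum>K\<in>words n. f (k # K))"
proof -
  have "inj_on (\<lambda>(i, I). i # I) ({1..N} \<times> words n)" by (auto simp: inj_on_def)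
  thus ?thesis unfolding words_Suc by (simp add: sum.reindex sum.cartesian_product case_prod_unfold)
qed

lemma entry_Nil [simp]: "entry [] [] = 1"
  by (simp add: entry_def)

lemma entry_Cons [simp]: "entry (i # I) (j # J) = u i j * entry I J"
  by (simp add: entry_def)

lemma entry_append: "length I = length J \<Longrightarrow> entry (I @ I') (J @ J') = entry I J * entry I' J'"
  by (simp add: entry_def)

lemma adj_u: "i \<in> {1..N} \<Longrightarrow> j \<in> {1..N} \<Longrightarrow> adj (u i j) = u i j"
  and u_idem: "i \<in> {1..N} \<Longrightarrow> j \<in> {1..N} \<Longrightarrow> u i j * u i j = u i j"
  and row_sum: "i \<in> {1..N} \<Longrightarrow> (\<Sum>j=1..N. u i j) = 1"
  and col_sum: "j \<in> {1..N} \<Longrightarrow> (\<Sum>i=1..N. u i j) = 1"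
  using magic by (auto simp: magic_unitary_def)

text \<open>The generators are self-adjoint, so the involution only reverses the product and stays
  within the same tensor power.\<close>

lemma adj_entry:
  assumes "I \<in> words n" "J \<in> words n"
  shows "adj (entry I J) = entry (rev I) (rev J)"
proof -
  have "length I = length J" using assms by (simp add: words_def)
  thus ?thesis using assms
  proof (induction I J arbitrary: n rule: list_induct2)
    case (Cons i I j J)
    from Cons.prems have "adj (entry I J) = entry (rev I) (rev J)"
      by (cases n) (auto simp: words_def intro!: Cons.IH)
    with Cons show ?case
      by (cases n) (auto simp: adj_mult entry_append adj_u words_def)
  qed simp
qed

lemma comult_entry:
  assumes "I \<in> words n" "J \<in> words n"
  shows "\<Delta> (entry I J) = (\<Sum>K\<in>words n. tens (entry I K) (entry K J))"
  using assms
proof (induction n arbitrary: I J)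
  case 0
  thus ?case using comult_hom by (simp add: unital_star_hom_def tens.tensor_one)
next
  case (Suc n)
  obtain i I' j J' where IJ: "I = i # I'" "J = j # J'" "i \<in> {1..N}" "j \<in> {1..N}" "I' \<in> words n" "J' \<in> words n"
    using Suc.prems unfolding words_Suc by auto
  have "\<Delta> (entry I J) = \<Delta> (u i j) * \<Delta> (entry I' J')"
    using comult_hom by (simp add: IJ unital_star_hom_def)
  also have "\<dots> = (\<Sum>k=1..N. \<Sum>K\<in>words n. tens (u i k) (u k j) * tens (entry I' K) (entry K J'))"
    using IJ by (simp add: comult_u Suc.IH sum_product)
  finally show ?case
    by (simp add: IJ sum_words_Suc tens.tensor_times)
qed

text \<open>Products concatenate words and the involution reverses them, so the span is a unital
  *-algebra containing the generators. The complex factor \<open>c\<close> is needed because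
  \<open>span\<close> is the real span.\<close>

lemma H_subset_span:
  "H \<subseteq> span {c *\<^sub>C entry I J | c n I J. I \<in> words n \<and> J \<in> words n}" (is "_ \<subseteq> span ?S")
proof
  fix x assume "x \<in> H"
  have S_scale: "c *\<^sub>C x \<in> ?S" if "x \<in> ?S" for c x
  proof -
    from that obtain d n I J where *: "x = d *\<^sub>C entry I J" "I \<in> words n" "J \<in> words n" by blast
    hence "c *\<^sub>C x = (c * d) *\<^sub>C entry I J" by (simp add: scaleC_scaleC)
    with * show ?thesis by blast
  qed
  have S_mult: "x * y \<in> ?S" if "x \<in> ?S" "y \<in> ?S" for x y
  proof -
    from that obtain c n I J d m I' J' where
      *: "x = c *\<^sub>C entry I J" "I \<in> words n" "J \<in> words n" "y = d *\<^sub>C entry I' J'" "I' \<in> words m" "J' \<in> words m"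
      by blast
    have "x * y = (c * d) *\<^sub>C entry (I @ I') (J @ J')"
      using * by (simp add: entry_append words_length scaleC_mult_left scaleC_mult_right scaleC_scaleC mult.commute)
    moreover have "I @ I' \<in> words (n + m)" "J @ J' \<in> words (n + m)"
      using * by (auto simp: words_def)
    ultimately show ?thesis by blast
  qed
  have S_adj: "adj x \<in> ?S" if "x \<in> ?S" for x
  proof -
    from that obtain c n I J where *: "x = c *\<^sub>C entry I J" "I \<in> words n" "J \<in> words n" by blast
    have "adj x = cnj c *\<^sub>C entry (rev I) (rev J)" using * by (simp add: adj_scaleC adj_entry)
    moreover have "rev I \<in> words n" "rev J \<in> words n" using * by (auto simp: words_def)
    ultimately show ?thesis by blast
  qed
  from \<open>x \<in> H\<close> show "x \<in> span ?S"
  proof (induction rule: gen_star_algebra.induct)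
    case (gen x)
    then obtain i j where ij: "x = u i j" "i \<in> {1..N}" "j \<in> {1..N}" by blast
    hence "x = 1 *\<^sub>C entry [i] [j]" "[i] \<in> words 1" "[j] \<in> words 1" by (auto simp: words_def)
    thus ?case by (intro span_base) blast
  next
    case one
    have "1 = 1 *\<^sub>C entry [] []" "[] \<in> words 0" by auto
    thus ?case by (intro span_base) blast
  next
    case (add x y)
    thus ?case by (intro span_add)
  next
    case (scale x c)
    show ?case
      by (rule span_linear_image_closed[OF bounded_linear.linear[OF bounded_linear_scaleC]
            span_base[OF S_scale] scale(2)])
  next
    case (mult x y)
    show ?case by (rule span_mult_closed[OF S_mult mult(3,4)])
  next
    case (adj x)
    show ?case
      by (rule span_linear_image_closed[OF bounded_linear.linear[OF bounded_linear_adj]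
            span_base[OF S_adj] adj(2)])
  qed
qed

lemma subspace_H: "subspace H"
proof (rule subspaceI)
  show "0 \<in> H"
    using gen_star_algebra.scale[OF gen_star_algebra.one, of 0] by simp
  show "r *\<^sub>R x \<in> H" if "x \<in> H" for r x
    using gen_star_algebra.scale[OF that, of "complex_of_real r"] by (simp add: scaleC_of_real)
qed (rule gen_star_algebra.add)

lemma H_dense_induct:
  assumes "closed {x. P x}" "\<And>x. x \<in> H \<Longrightarrow> P x"
  shows "P x"
  using closure_minimal[of H "{x. P x}"] assms generates by auto

text \<open>Entries span a dense subspace and states are continuous, so identities between states
  reduce to identities between finite matrices.\<close>

lemma states_eqI:
  assumes "\<phi> \<in> states" "\<psi> \<in> states"
    and eq: "\<And>n I J. I \<in> words n \<Longrightarrow> J \<in> words n \<Longrightarrow> \<phi> (entry I J) = \<psi> (entry I J)"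
  shows "\<phi> = \<psi>"
proof
  interpret f: positive_functional \<phi> using assms(1) by (rule states_positive)
  interpret g: positive_functional \<psi> using assms(2) by (rule states_positive)
  fix x show "\<phi> x = \<psi> x"
  proof (rule H_dense_induct)
    fix x assume "x \<in> H"
    with H_subset_span have "x \<in> span {c *\<^sub>C entry I J | c n I J. I \<in> words n \<and> J \<in> words n}" by blast
    thus "\<phi> x = \<psi> x"
      by (rule linear_eq_on_span[OF f.linear g.linear, rotated])
        (auto simp: f.scale g.scale eq)
  qed (intro closed_Collect_eq continuous_intros
      bounded_linear.continuous_on[OF state_bounded_linear] assms)
qed

lemma conv_state:
  assumes "\<phi> \<in> states" "\<psi> \<in> states"
  shows "conv \<phi> \<psi> \<in> states"
proof -
  define F where "F = tensor_ext tens (\<lambda>a b. \<phi> a * \<psi> b)"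
  have F: "F \<in> states"
    unfolding F_def by (rule tens.tensor_ext_state) fact+
  interpret F: positive_functional F using F by (rule states_positive)
  have hom: "\<Delta> (x + y) = \<Delta> x + \<Delta> y" "\<Delta> (c *\<^sub>C x) = c *\<^sub>C \<Delta> x"
    "\<Delta> (adj x * x) = adj (\<Delta> x) * \<Delta> x" "\<Delta> 1 = 1" for x y c
    using comult_hom by (auto simp: unital_star_hom_def)
  have "positive_functional (\<lambda>x. F (\<Delta> x))"
    by standard (simp_all only: hom F.add F.scale F.pos)
  moreover have "F (\<Delta> 1) = 1" by (simp only: hom states_one[OF F])
  ultimately show ?thesis by (simp add: states_iff convolution_def F_def o_def)
qed

lemma conv_entry:
  assumes "\<phi> \<in> states" "\<psi> \<in> states" "I \<in> words n" "J \<in> words n"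
  shows "conv \<phi> \<psi> (entry I J) = (\<Sum>K\<in>words n. \<phi> (entry I K) * \<psi> (entry K J))"
  unfolding convolution_def using assms(3,4)
  by (simp add: comult_entry tens.tensor_ext_states(2)[OF assms(1,2)]
      linear_sum[OF bounded_linear.linear[OF tens.tensor_ext_states(1)[OF assms(1,2)]]])

lemma sum_words_1: "(\<Sum>K\<in>words (Suc 0). f K) = (\<Sum>k=1..N. f [k])"
  by (simp add: sum_words_Suc)

lemma conv_u:
  assumes "\<phi> \<in> states" "\<psi> \<in> states" "i \<in> {1..N}" "j \<in> {1..N}"
  shows "conv \<phi> \<psi> (u i j) = (\<Sum>k=1..N. \<phi> (u i k) * \<psi> (u k j))"
  using conv_entry[OF assms(1,2), of "[i]" "Suc 0" "[j]"] assms(3,4) by (simp add: sum_words_1)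

section \<open>Unitarity of the tensor powers, tested by positive functionals\<close>

text \<open>Projections summing to 1 are mutually orthogonal. Inserting the row sum between two
  copies of \<open>u i k\<close> writes \<open>\<phi> (adj z * u i k * z)\<close> as a sum of
  nonnegative terms \<open>\<phi> (adj (w l) * w l)\<close>; the term \<open>l = k\<close> is
  already the whole sum, so the others vanish, and Cauchy-Schwarz finishes.\<close>

lemma u_orthogonal:
  assumes \<phi>: "positive_functional \<phi>"
    and ij: "i \<in> {1..N}" "j \<in> {1..N}" "k \<in> {1..N}" "j \<noteq> k"
  shows "\<phi> (adj y * (u i j * u i k) * z) = 0"
proof -
  interpret positive_functional \<phi> by fact
  define w where "w l = u i l * u i k * z" for l
  have sq: "adj (w l) * w l = adj z * (u i k * u i l * u i k) * z" if "l \<in> {1..N}" for l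
    using that ij u_idem[of i l]
    by (simp add: w_def adj_mult adj_u mult.assoc) (simp add: mult.assoc[symmetric])
  have "adj z * u i k * z = adj z * (u i k * (\<Sum>l=1..N. u i l) * u i k) * z"
    unfolding row_sum[OF ij(1)] using ij by (simp add: u_idem)
  also have "\<dots> = (\<Sum>l=1..N. adj (w l) * w l)"
    unfolding sum_distrib_left sum_distrib_right by (rule sum.cong) (simp_all add: sq)
  finally have "\<phi> (adj z * u i k * z) = (\<Sum>l=1..N. \<phi> (adj (w l) * w l))"
    by (simp add: sum)
  also have "\<dots> = \<phi> (adj (w k) * w k) + (\<Sum>l\<in>{1..N}-{k}. \<phi> (adj (w l) * w l))"
    using ij by (intro sum.remove) auto
  also have "adj (w k) * w k = adj z * u i k * z"
    using ij by (simp add: sq u_idem)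
  finally have "(\<Sum>l\<in>{1..N}-{k}. Re (\<phi> (adj (w l) * w l))) = 0"
    by (simp add: Re_sum[symmetric])
  hence "\<forall>l\<in>{1..N}-{k}. Re (\<phi> (adj (w l) * w l)) = 0"
    by (subst (asm) sum_nonneg_eq_0_iff) (auto intro: pos_Re)
  hence "\<phi> (adj (w j) * w j) = 0"
    using ij pos_of_real[of "w j"] by auto
  hence "\<phi> (adj y * w j) = 0" by (rule Cauchy_Schwarz_null)
  thus ?thesis by (simp add: w_def mult.assoc)
qed

text \<open>The first letters of the words meet in the middle of the product. Summing over the first
  letter of \<open>I\<close> gives a Kronecker delta, by the column sum or by
  \<open>u_orthogonal\<close>, and the remaining letters are left to the induction
  hypothesis.\<close>

lemma entry_unitary:
  assumes \<phi>: "positive_functional \<phi>" and "J \<in> words n" "K \<in> words n"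
  shows "(\<Sum>I\<in>words n. \<phi> (adj y * (adj (entry I J) * entry I K) * z)) = (if J = K then \<phi> (adj y * z) else 0)"
  using assms(2,3)
proof (induction n arbitrary: J K)
  case (Suc n)
  interpret positive_functional \<phi> by fact
  obtain j J' k K' where JK: "J = j # J'" "K = k # K'" "j \<in> {1..N}" "k \<in> {1..N}" "J' \<in> words n" "K' \<in> words n"
    using Suc.prems unfolding words_Suc by auto
  have inner: "(\<Sum>i=1..N. \<phi> (adj a * (u i j * u i k) * b)) = (if j = k then \<phi> (adj a * b) else 0)" for a b
  proof (cases "j = k")
    case True
    have "(\<Sum>i=1..N. \<phi> (adj a * (u i j * u i k) * b)) = \<phi> (adj a * (\<Sum>i=1..N. u i j) * b)"
      using JK True by (simp add: u_idem sum sum_distrib_left sum_distrib_right)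
    thus ?thesis unfolding col_sum[OF JK(3)] using True by simp
  next
    case False
    thus ?thesis using JK by (auto intro!: sum.neutral u_orthogonal \<phi>)
  qed
  have "(\<Sum>I\<in>words (Suc n). \<phi> (adj y * (adj (entry I J) * entry I K) * z)) =
      (\<Sum>i=1..N. \<Sum>I\<in>words n. \<phi> (adj (entry I J' * y) * (u i j * u i k) * (entry I K' * z)))"
    unfolding sum_words_Suc using JK by (simp add: adj_mult adj_u mult.assoc)
  also have "\<dots> = (\<Sum>I\<in>words n. if j = k then \<phi> (adj (entry I J' * y) * (entry I K' * z)) else 0)"
    by (subst sum.swap) (simp only: inner)
  also have "\<dots> = (if j = k then (\<Sum>I\<in>words n. \<phi> (adj y * (adj (entry I J') * entry I K') * z)) else 0)"
    by (auto simp: adj_mult mult.assoc)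
  also have "\<dots> = (if J = K then \<phi> (adj y * z) else 0)"
    using JK by (simp add: Suc.IH)
  finally show ?case .
qed simp

lemma contraction_entry:
  assumes "\<phi> \<in> states"
  shows "contraction_on (words n) (\<lambda>I J. \<phi> (entry I J))"
  unfolding contraction_on_def
proof
  fix \<xi> :: "nat list \<Rightarrow> complex"
  interpret positive_functional \<phi> using assms by (rule states_positive)
  \<comment> \<open>\<open>x\<close> is the matrix of entries applied to \<open>\<xi>\<close>.
    Cauchy-Schwarz is used in each row, and by \<open>entry_unitary\<close> the values of
    \<open>\<phi>\<close> at \<open>adj (x I) * x I\<close> add up to the squared norm of
    \<open>\<xi>\<close>.\<close>
  define x where "x I = (\<Sum>J\<in>words n. \<xi> J *\<^sub>C entry I J)" for I
  have adj_x: "adj (x I) = (\<Sum>J\<in>words n. cnj (\<xi> J) *\<^sub>C adj (entry I J))" for I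
    unfolding x_def linear_sum[OF bounded_linear.linear[OF bounded_linear_adj]] adj_scaleC ..
  have square: "\<phi> (adj (x I) * x I) =
      (\<Sum>J\<in>words n. \<Sum>K\<in>words n. cnj (\<xi> J) * \<xi> K * \<phi> (adj (entry I J) * entry I K))" for I
    unfolding adj_x unfolding x_def sum_product
    by (simp add: sum scaleC_mult_left scaleC_mult_right scaleC_scaleC scale mult.commute)
  have "(\<Sum>I\<in>words n. (cmod (\<Sum>J\<in>words n. \<phi> (entry I J) * \<xi> J))\<^sup>2) \<le> (\<Sum>I\<in>words n. Re (\<phi> (adj (x I) * x I)))"
  proof (rule sum_mono)
    fix I
    have "(\<Sum>J\<in>words n. \<phi> (entry I J) * \<xi> J) = \<phi> (adj 1 * x I)"
      by (simp add: x_def sum scale mult.commute)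
    thus "(cmod (\<Sum>J\<in>words n. \<phi> (entry I J) * \<xi> J))\<^sup>2 \<le> Re (\<phi> (adj (x I) * x I))"
      using Cauchy_Schwarz[of 1 "x I"] by (simp add: states_one[OF assms])
  qed
  also have "\<dots> = Re (\<Sum>I\<in>words n. \<Sum>J\<in>words n. \<Sum>K\<in>words n. cnj (\<xi> J) * \<xi> K * \<phi> (adj (entry I J) * entry I K))"
    by (simp only: square Re_sum)
  also have "(\<Sum>I\<in>words n. \<Sum>J\<in>words n. \<Sum>K\<in>words n. cnj (\<xi> J) * \<xi> K * \<phi> (adj (entry I J) * entry I K)) =
      (\<Sum>J\<in>words n. \<Sum>K\<in>words n. cnj (\<xi> J) * \<xi> K * (\<Sum>I\<in>words n. \<phi> (adj (entry I J) * entry I K)))"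
    unfolding sum_distrib_left by (subst sum.swap) (rule sum.cong[OF refl], rule sum.swap)
  also have "\<dots> = (\<Sum>J\<in>words n. cnj (\<xi> J) * \<xi> J)"
  proof (rule sum.cong[OF refl])
    fix J assume J: "J \<in> words n"
    have "(\<Sum>K\<in>words n. cnj (\<xi> J) * \<xi> K * (\<Sum>I\<in>words n. \<phi> (adj (entry I J) * entry I K))) =
        (\<Sum>K\<in>words n. if J = K then cnj (\<xi> J) * \<xi> K else 0)"
      using entry_unitary[OF positive_functional_axioms J, of _ 1 1] states_one[OF assms]
      by (intro sum.cong) auto
    also have "\<dots> = cnj (\<xi> J) * \<xi> J" using J by simp
    finally show "(\<Sum>K\<in>words n. cnj (\<xi> J) * \<xi> K * (\<Sum>I\<in>words n. \<phi> (adj (entry I J) * entry I K))) = cnj (\<xi> J) * \<xi> J" .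
  qed
  also have "Re \<dots> = (\<Sum>J\<in>words n. (cmod (\<xi> J))\<^sup>2)" by (rule sum_cnj_mult_self)
  finally show "(\<Sum>I\<in>words n. (cmod (\<Sum>J\<in>words n. \<phi> (entry I J) * \<xi> J))\<^sup>2) \<le> (\<Sum>J\<in>words n. (cmod (\<xi> J))\<^sup>2)" .
qed

end

section \<open>The counit\<close>

text \<open>Applied to rows and columns of the matrix of counit values, this makes it a permutation
  matrix.\<close>

lemma zero_one_sum_eq_1D:
  fixes f :: "'i \<Rightarrow> complex"
  assumes "finite X" "\<And>l. l \<in> X \<Longrightarrow> f l = 0 \<or> f l = 1" "(\<Sum>l\<in>X. f l) = 1"
    and "k \<in> X" "f k = 1" "l \<in> X" "f l = 1"
  shows "l = k"
proof (rule ccontr)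
  assume "l \<noteq> k"
  have "0 \<le> Re (f l)" if "l \<in> X" for l using assms(2)[OF that] by auto
  hence "(\<Sum>l\<in>{k, l}. Re (f l)) \<le> (\<Sum>l\<in>X. Re (f l))"
    using assms by (intro sum_mono2) auto
  also have "\<dots> = Re (\<Sum>l\<in>X. f l)" by simp
  finally show False using assms \<open>l \<noteq> k\<close> by simp
qed

context quantum_permutation_group
begin

lemma u_in_H: "i \<in> {1..N} \<Longrightarrow> j \<in> {1..N} \<Longrightarrow> u i j \<in> H"
  by (rule gen_star_algebra.gen) blast

lemma H_sum: "(\<And>k. k \<in> X \<Longrightarrow> f k \<in> H) \<Longrightarrow> (\<Sum>k\<in>X. f k) \<in> H"
  by (rule subspace_sum[OF subspace_H])

text \<open>The Hopf structure does not prescribe the values at \<open>u i j\<close>.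
  Multiplicativity makes them 0 or 1, with a single 1 in each row and column. A 1 at
  \<open>(i, k)\<close> with \<open>i \<noteq> k\<close> would turn the counit law for
  \<open>u i k\<close> into \<open>u k k = u i k\<close>, giving column \<open>k\<close> a second
  1.\<close>

lemma counit_on_H:
  obtains e :: "'a \<Rightarrow> complex" where
    "\<And>x y. x \<in> H \<Longrightarrow> y \<in> H \<Longrightarrow> e (x + y) = e x + e y" "\<And>c x. x \<in> H \<Longrightarrow> e (c *\<^sub>C x) = c * e x"
    "\<And>x y. x \<in> H \<Longrightarrow> y \<in> H \<Longrightarrow> e (x * y) = e x * e y" "e 1 = 1"
    "\<And>i j. i \<in> {1..N} \<Longrightarrow> j \<in> {1..N} \<Longrightarrow> e (u i j) = (if i = j then 1 else 0)"
proof -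
  obtain e :: "'a \<Rightarrow> complex" and S :: "'a \<Rightarrow> 'a" where
    hopf_e: "\<forall>x\<in>H. \<forall>y\<in>H. e (x + y) = e x + e y" "\<forall>c. \<forall>x\<in>H. e (c *\<^sub>C x) = c * e x"
      "\<forall>x\<in>H. \<forall>y\<in>H. e (x * y) = e x * e y" and one: "e 1 = 1" and
    hopf_counit: "\<forall>x\<in>H. \<forall>xs. set xs \<subseteq> H \<times> H \<and> \<Delta> x = tensor_sum tens xs \<longrightarrow>
           (\<Sum>(a, b)\<leftarrow>xs. e a *\<^sub>C b) = x \<and>
           (\<Sum>(a, b)\<leftarrow>xs. e b *\<^sub>C a) = x \<and>
           (\<Sum>(a, b)\<leftarrow>xs. S a * b) = e x *\<^sub>C 1 \<and>
           (\<Sum>(a, b)\<leftarrow>xs. a * S b) = e x *\<^sub>C 1"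
    using hopf unfolding hopf_star_algebra_on_def by (elim conjE exE) (rule that; assumption)
  have add: "e (x + y) = e x + e y" and mult: "e (x * y) = e x * e y" if "x \<in> H" "y \<in> H" for x y
    using hopf_e(1,3) that by blast+
  have scale: "e (c *\<^sub>C x) = c * e x" if "x \<in> H" for c x
    using hopf_e(2) that by blast
  have counit: "(\<Sum>(a, b)\<leftarrow>xs. e a *\<^sub>C b) = x"
    if "x \<in> H" "set xs \<subseteq> H \<times> H" "\<Delta> x = tensor_sum tens xs" for x xs
    using hopf_counit that by blast
  have zero: "e 0 = 0"
    using scale[OF gen_star_algebra.one, of 0] by simp
  have sum: "e (\<Sum>k\<in>X. f k) = (\<Sum>k\<in>X. e (f k))" if "finite X" "\<And>k. k \<in> X \<Longrightarrow> f k \<in> H" for f and X :: "nat set"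
    using that
  proof (induction X rule: finite_induct)
    case (insert k X)
    hence "f k \<in> H" "sum f X \<in> H" by (blast intro: H_sum)+
    with insert show ?case by (simp add: add del: One_nat_def)
  qed (simp add: zero)
  have zo: "e (u i j) = 0 \<or> e (u i j) = 1" if "i \<in> {1..N}" "j \<in> {1..N}" for i j
    using mult[OF u_in_H[OF that] u_in_H[OF that]] u_idem[OF that] by simp
  have row: "(\<Sum>j=1..N. e (u i j)) = 1" if "i \<in> {1..N}" for i
    using sum[of "{1..N}" "u i"] u_in_H that row_sum[OF that] one by simp
  have col: "(\<Sum>i=1..N. e (u i j)) = 1" if "j \<in> {1..N}" for j
    using sum[of "{1..N}" "\<lambda>i. u i j"] u_in_H that col_sum[OF that] one by simp
  have row_unique: "l = k" if "i \<in> {1..N}" "k \<in> {1..N}" "e (u i k) = 1" "l \<in> {1..N}" "e (u i l) = 1" for i k l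
    using that by - (rule zero_one_sum_eq_1D[where f = "\<lambda>l. e (u i l)", OF finite_atLeastAtMost zo row]; assumption?)
  have col_unique: "l = k" if "i \<in> {1..N}" "k \<in> {1..N}" "e (u k i) = 1" "l \<in> {1..N}" "e (u l i) = 1" for i k l
    using that by - (rule zero_one_sum_eq_1D[where f = "\<lambda>l. e (u l i)", OF finite_atLeastAtMost zo col]; assumption?)
  have off: "e (u i k) = 0" if i: "i \<in> {1..N}" and k: "k \<in> {1..N}" and "i \<noteq> k" for i k
  proof (rule ccontr)
    assume "e (u i k) \<noteq> 0"
    hence ik: "e (u i k) = 1" using zo[OF i k] by simp
    have row_i: "e (u i l) = (if l = k then 1 else 0)" if "l \<in> {1..N}" for l
      using row_unique[OF i k ik that] zo[OF i that] ik by metis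
    \<comment> \<open>The counit law is stated for lists, so the sum for
      \<open>\<Delta> (u i k)\<close> is written as one.\<close>
    define xs where "xs = map (\<lambda>l. (u i l, u l k)) [1..<Suc N]"
    have "(\<Sum>(a, b)\<leftarrow>xs. e a *\<^sub>C b) = u i k"
    proof (rule counit)
      show "\<Delta> (u i k) = tensor_sum tens xs"
        using i k by (simp add: comult_u tensor_sum_def xs_def o_def interv_sum_list_conv_sum_set_nat
            atLeastLessThanSuc_atLeastAtMost del: upt_Suc)
      have set_xs: "set xs = (\<lambda>l. (u i l, u l k)) ` {1..N}"
        by (simp add: xs_def atLeastLessThanSuc_atLeastAtMost del: upt_Suc)
      show "set xs \<subseteq> H \<times> H" unfolding set_xs by (intro image_subsetI SigmaI u_in_H i k)
      show "u i k \<in> H" using i k by (rule u_in_H)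
    qed
    moreover have "(\<Sum>(a, b)\<leftarrow>xs. e a *\<^sub>C b) = (\<Sum>l=1..N. e (u i l) *\<^sub>C u l k)"
      by (simp add: xs_def o_def interv_sum_list_conv_sum_set_nat
          atLeastLessThanSuc_atLeastAtMost del: upt_Suc)
    moreover have "\<dots> = (\<Sum>l=1..N. if l = k then u l k else 0)"
      by (rule sum.cong[OF refl]) (simp add: row_i del: One_nat_def)
    ultimately have "u k k = u i k" using k by simp
    hence "e (u k k) = 1" using ik by simp
    thus False using col_unique[OF k k _ i ik] \<open>i \<noteq> k\<close> by simp
  qed
  have "e (u i i) = 1" if i: "i \<in> {1..N}" for i
  proof -
    have "(\<Sum>j=1..N. e (u i j)) = (\<Sum>j=1..N. if j = i then e (u i i) else 0)"
      by (rule sum.cong) (use off i in auto)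
    thus ?thesis using row[OF i] i by simp
  qed
  hence eu: "e (u i j) = (if i = j then 1 else 0)" if "i \<in> {1..N}" "j \<in> {1..N}" for i j
    using off that by simp
  show ?thesis by (rule that[of e]; rule add scale mult one eu; assumption)
qed

text \<open>The modulus of the algebraic counit is a C*-seminorm on \<open>H\<close>. Universality
  bounds it by the norm, so the counit extends to a character of the whole algebra.\<close>

lemma counit_state:
  obtains \<epsilon> where "\<epsilon> \<in> states"
    "\<And>i j. i \<in> {1..N} \<Longrightarrow> j \<in> {1..N} \<Longrightarrow> \<epsilon> (u i j) = (if i = j then 1 else 0)"
proof -
  obtain e :: "'a \<Rightarrow> complex" where
    add: "\<And>x y. x \<in> H \<Longrightarrow> y \<in> H \<Longrightarrow> e (x + y) = e x + e y" and
    scale: "\<And>c x. x \<in> H \<Longrightarrow> e (c *\<^sub>C x) = c * e x" and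
    mult: "\<And>x y. x \<in> H \<Longrightarrow> y \<in> H \<Longrightarrow> e (x * y) = e x * e y" and one: "e 1 = 1" and
    eu: "\<And>i j. i \<in> {1..N} \<Longrightarrow> j \<in> {1..N} \<Longrightarrow> e (u i j) = (if i = j then 1 else 0)"
    by (rule counit_on_H) (rule that; assumption)
  \<comment> \<open>Compatibility with the involution follows by induction from the real values on
    the self-adjoint generators.\<close>
  have star: "e (adj x) = cnj (e x)" if "x \<in> H" for x
    using that
  proof (induction rule: gen_star_algebra.induct)
    case (gen x)
    then obtain i j where "x = u i j" "i \<in> {1..N}" "j \<in> {1..N}" by blast
    thus ?case by (simp add: adj_u eu del: One_nat_def)
  qed (auto simp: one adj_add adj_scaleC adj_mult adj_adj add scale mult gen_star_algebra.adj)
  have "cstar_seminorm_on H (\<lambda>x. cmod (e x))"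
    unfolding cstar_seminorm_on_def
  proof (intro conjI ballI allI)
    show "cmod (e (x + y)) \<le> cmod (e x) + cmod (e y)" if "x \<in> H" "y \<in> H" for x y
      unfolding add[OF that] by (rule norm_triangle_ineq)
    show "cmod (e (adj x * x)) = (cmod (e x))\<^sup>2" if "x \<in> H" for x
      unfolding mult[OF gen_star_algebra.adj[OF that] that] star[OF that]
      by (simp add: norm_mult power2_eq_square)
  qed (simp_all add: scale mult norm_mult)
  hence bound: "norm (e x) \<le> norm x" if "x \<in> H" for x
    using universal that by blast
  obtain F where F: "bounded_linear F" and Fe: "\<And>x. x \<in> H \<Longrightarrow> F x = e x"
  proof (rule bounded_linear_extension[OF subspace_H generates, of e])
    show "e (r *\<^sub>R x) = r *\<^sub>R e x" if "x \<in> H" for r x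
      using scale[OF that, of "complex_of_real r"] by (simp add: scaleC_of_real scaleR_conv_of_real)
  qed (use add bound in auto)
  interpret F: bounded_linear F by fact
  have "F \<in> states"
    unfolding states_iff positive_functional_def
  proof (intro conjI allI)
    show "F 1 = 1" using Fe[OF gen_star_algebra.one] one by simp
    show "F (c *\<^sub>C x) = c * F x" for c x
    proof (rule H_dense_induct)
      show "F (c *\<^sub>C x) = c * F x" if "x \<in> H" for x
        using Fe[OF that] Fe[OF gen_star_algebra.scale[OF that, of c]] scale[OF that] by simp
    qed (intro closed_Collect_eq F.continuous_on continuous_intros
        bounded_linear.continuous_on[OF bounded_linear_scaleC])
    show "F (adj x * x) \<in> \<real>\<^sub>\<ge>\<^sub>0" for x
    proof (rule H_dense_induct[where P = "\<lambda>x. F (adj x * x) \<in> \<real>\<^sub>\<ge>\<^sub>0"])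
      have "closed ((\<lambda>x. F (adj x * x)) -` \<real>\<^sub>\<ge>\<^sub>0)"
        by (intro closed_vimage closed_nonneg_Reals_complex F.continuous_on continuous_intros)
      thus "closed {x. F (adj x * x) \<in> \<real>\<^sub>\<ge>\<^sub>0}" by (simp add: vimage_def)
      fix x assume x: "x \<in> H"
      have "F (adj x * x) = cnj (e x) * e x"
        using x by (simp add: Fe gen_star_algebra.mult gen_star_algebra.adj mult star)
      also have "\<dots> = complex_of_real ((cmod (e x))\<^sup>2)"
        using complex_norm_square[of "e x"] by (simp add: mult.commute)
      finally show "F (adj x * x) \<in> \<real>\<^sub>\<ge>\<^sub>0" by simp
    qed
  qed (rule F.add)
  thus ?thesis by (rule that) (simp only: Fe u_in_H eu)
qed

section \<open>The invariant state\<close>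

text \<open>For states this says \<open>conv \<psi> f = f\<close>, read off on matrix coefficients.
  Each equation involves finitely many values of \<open>f\<close>, so the set is closed under
  pointwise convergence.\<close>

definition left_invariant :: "('a \<Rightarrow> complex) \<Rightarrow> ('a \<Rightarrow> complex) set" where
  "left_invariant \<psi> = {f. \<forall>n. \<forall>I\<in>words n. \<forall>J\<in>words n. (\<Sum>L\<in>words n. \<psi> (entry I L) * f (entry L J)) = f (entry I J)}"

lemma closed_left_invariant: "closed (left_invariant \<psi>)"
proof -
  have "closed {f. \<forall>n I J. I \<in> words n \<longrightarrow> J \<in> words n \<longrightarrow>
      (\<Sum>L\<in>words n. \<psi> (entry I L) * f (entry L J)) = f (entry I J)}"
    by (intro closed_Collect_all closed_Collect_imp open_Collect_const closed_Collect_eq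
      continuous_on_sum continuous_on_mult continuous_on_const continuous_eval)
  also have "{f. \<forall>n I J. I \<in> words n \<longrightarrow> J \<in> words n \<longrightarrow>
      (\<Sum>L\<in>words n. \<psi> (entry I L) * f (entry L J)) = f (entry I J)} = left_invariant \<psi>"
    by (auto simp only: left_invariant_def)
  finally show ?thesis .
qed

text \<open>An approximate fixed point exists because the Cesaro means of the convolution powers of
  \<open>\<psi>\<close> are moved by at most \<open>2 / m\<close>.\<close>

lemma left_invariant_meets:
  assumes K: "K \<subseteq> states" "closed K" and \<psi>: "\<psi> \<in> K"
    and conv: "\<And>\<phi>. \<phi> \<in> K \<Longrightarrow> conv \<psi> \<phi> \<in> K"
    and average: "\<And>m \<phi>. 0 < m \<Longrightarrow> (\<And>k. k < m \<Longrightarrow> \<phi> k \<in> K) \<Longrightarrow> (\<lambda>x. (\<Sum>k<m. \<phi> k x) / of_nat m) \<in> K"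
  shows "K \<inter> left_invariant \<psi> \<noteq> {}"
proof -
  define defect where "defect f n I J = (\<Sum>L\<in>words n. \<psi> (entry I L) * f (entry L J)) - f (entry I J)" for f n I J
  \<comment> \<open>Approximate solutions: closed sets, decreasing in \<open>m\<close>, with only
    exact solutions in their intersection.\<close>
  define D where "D m = {f. \<forall>n. \<forall>I\<in>words n. \<forall>J\<in>words n. cmod (defect f n I J) \<le> 2 * norm (entry I J) / real (Suc m)}" for m
  \<comment> \<open>Indices are shifted by one: \<open>pow 0\<close> is \<open>\<psi>\<close>
    itself.\<close>
  define pow where "pow k = (conv \<psi> ^^ k) \<psi>" for k
  have pow_K: "pow k \<in> K" for k
    by (induction k) (auto simp: pow_def \<psi> conv)
  have closed_D: "closed (D m)" for m
  proof -
    have "closed {f. \<forall>n I J. I \<in> words n \<longrightarrow> J \<in> words n \<longrightarrow>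
        cmod (defect f n I J) \<le> 2 * norm (entry I J) / real (Suc m)}"
      unfolding defect_def
      by (intro closed_Collect_all closed_Collect_imp open_Collect_const closed_Collect_le
          continuous_on_norm continuous_on_diff continuous_on_sum continuous_on_mult
          continuous_on_const continuous_eval)
    also have "{f. \<forall>n I J. I \<in> words n \<longrightarrow> J \<in> words n \<longrightarrow>
        cmod (defect f n I J) \<le> 2 * norm (entry I J) / real (Suc m)} = D m"
      by (auto simp only: D_def)
    finally show ?thesis .
  qed
  have nonempty: "K \<inter> D m \<noteq> {}" for m
  proof -
    define h where "h x = (\<Sum>k<Suc m. pow k x) / of_nat (Suc m)" for x
    have "cmod (defect h n I J) \<le> 2 * norm (entry I J) / real (Suc m)" if "I \<in> words n" "J \<in> words n" for n I J
    proof -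
      have step: "(\<Sum>L\<in>words n. \<psi> (entry I L) * pow k (entry L J)) = pow (Suc k) (entry I J)" for k
        using conv_entry[OF subsetD[OF K(1) \<psi>] subsetD[OF K(1) pow_K] that] by (simp add: pow_def)
      have "(\<Sum>L\<in>words n. \<psi> (entry I L) * h (entry L J)) =
          (\<Sum>k<Suc m. \<Sum>L\<in>words n. \<psi> (entry I L) * pow k (entry L J)) / of_nat (Suc m)"
        unfolding h_def by (subst sum.swap) (simp add: sum_distrib_left sum_divide_distrib del: sum.lessThan_Suc)
      hence "defect h n I J = (\<Sum>k<Suc m. pow (Suc k) (entry I J) - pow k (entry I J)) / of_nat (Suc m)"
        unfolding step defect_def h_def by (simp add: sum_subtractf diff_divide_distrib del: sum.lessThan_Suc)
      \<comment> \<open>Only the two end terms survive; each is bounded by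
        \<open>norm (entry I J)\<close>, hence the factor 2 in \<open>D\<close>.\<close>
      also have "\<dots> = (pow (Suc m) (entry I J) - pow 0 (entry I J)) / of_nat (Suc m)"
        by (subst sum_lessThan_telescope) simp
      finally have "cmod (defect h n I J) = cmod (pow (Suc m) (entry I J) - pow 0 (entry I J)) / real (Suc m)"
        by (simp only: norm_divide norm_of_nat)
      moreover have "cmod (pow (Suc m) (entry I J) - pow 0 (entry I J)) \<le> norm (entry I J) + norm (entry I J)"
        using pow_K K(1) by (intro norm_triangle_le_diff add_mono states_norm_le) auto
      ultimately show ?thesis by (simp add: divide_right_mono)
    qed
    moreover have "h \<in> K" unfolding h_def[abs_def] by (rule average) (simp_all add: pow_K)
    ultimately show ?thesis by (auto simp: D_def)
  qed
  have anti: "D m \<subseteq> D k" if "k \<le> m" for k m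
  proof -
    have "2 * norm (entry I J) / real (Suc m) \<le> 2 * norm (entry I J) / real (Suc k)" for I J
      using that by (intro divide_left_mono) auto
    thus ?thesis unfolding D_def by (blast intro: order_trans)
  qed
  have "compact K" using compact_Int_closed[OF compact_states K(2)] K(1) by (simp add: Int_absorb1)
  hence "K \<inter> (\<Inter>m. D m) \<noteq> {}"
  proof (rule compact_imp_fip_image)
    fix B :: "nat set" assume "finite B"
    \<comment> \<open>The sets are nested, so the largest index suffices; inserting 0 covers the
      empty family.\<close>
    hence "D (Max (insert 0 B)) \<subseteq> (\<Inter>m\<in>B. D m)" by (intro INT_greatest anti Max_ge) auto
    thus "K \<inter> (\<Inter>m\<in>B. D m) \<noteq> {}" using nonempty[of "Max (insert 0 B)"] by blast
  qed (rule closed_D)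
  then obtain f where f: "f \<in> K" "\<And>m. f \<in> D m" by blast
  have "defect f n I J = 0" if "I \<in> words n" "J \<in> words n" for n I J
  proof -
    have "(\<lambda>m. 2 * norm (entry I J) / real (Suc m)) \<longlonglongrightarrow> 0"
      using tendsto_mult[OF tendsto_const LIMSEQ_inverse_real_of_nat, of "2 * norm (entry I J)"]
      by (simp add: field_simps)
    hence "cmod (defect f n I J) \<le> 0"
      by (rule LIMSEQ_le_const) (use f(2) that in \<open>auto simp: D_def\<close>)
    thus ?thesis by simp
  qed
  hence "f \<in> left_invariant \<psi>" by (auto simp: left_invariant_def defect_def)
  with f show ?thesis by blast
qed

text \<open>For fixed \<open>J\<close> the values \<open>f (entry L J)\<close> form a vector fixed
  by the midpoint of two contractions, as in \<open>contraction_average_fixed\<close>. The second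
  claim exchanges the roles.\<close>

lemma left_invariant_average:
  assumes "\<phi> \<in> states" "\<psi> \<in> states" "f \<in> left_invariant (\<lambda>x. (\<phi> x + \<psi> x) / 2)"
  shows "f \<in> left_invariant \<phi>" "f \<in> left_invariant \<psi>"
proof -
  have *: "f \<in> left_invariant \<phi>"
    if "\<phi> \<in> states" "\<psi> \<in> states" "f \<in> left_invariant (\<lambda>x. (\<phi> x + \<psi> x) / 2)" for \<phi> \<psi>
    unfolding left_invariant_def
  proof (intro CollectI allI ballI)
    fix n I J assume I: "I \<in> words n" and J: "J \<in> words n"
    show "(\<Sum>L\<in>words n. \<phi> (entry I L) * f (entry L J)) = f (entry I J)"
      by (rule contraction_average_fixed[OF finite_words contraction_entry[OF that(1)] contraction_entry[OF that(2)] _ I])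
        (use that(3) J in \<open>auto simp: left_invariant_def\<close>)
  qed
  show "f \<in> left_invariant \<phi>" using * assms by blast
  show "f \<in> left_invariant \<psi>" using *[of \<psi> \<phi>] assms by (simp add: add.commute)
qed

lemma invariant_state_exists:
  assumes K: "K \<subseteq> states" "closed K" "K \<noteq> {}"
    and conv: "\<And>\<phi> \<psi>. \<phi> \<in> K \<Longrightarrow> \<psi> \<in> K \<Longrightarrow> conv \<phi> \<psi> \<in> K"
    and average: "\<And>m \<phi>. 0 < m \<Longrightarrow> (\<And>k. k < m \<Longrightarrow> \<phi> k \<in> K) \<Longrightarrow> (\<lambda>x. (\<Sum>k<m. \<phi> k x) / of_nat m) \<in> K"
  obtains h where "h \<in> K" "\<And>\<psi>. \<psi> \<in> K \<Longrightarrow> h \<in> left_invariant \<psi>"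
proof -
  \<comment> \<open>Repeated midpoints replace a finite family by one state whose invariant
    functions are invariant under the whole family.\<close>
  have dominating: "\<exists>\<omega>\<in>K. left_invariant \<omega> \<subseteq> (\<Inter>\<psi>\<in>F. left_invariant \<psi>)" if "finite F" "F \<subseteq> K" for F
    using that
  proof (induction F rule: finite_induct)
    case (insert \<psi> F)
    then obtain \<omega> where \<omega>: "\<omega> \<in> K" "left_invariant \<omega> \<subseteq> (\<Inter>\<psi>\<in>F. left_invariant \<psi>)" by auto
    have "(\<lambda>x. (\<psi> x + \<omega> x) / 2) \<in> K"
      using average[of 2 "\<lambda>k. if k = 0 then \<psi> else \<omega>"] insert \<omega> by (simp add: numeral_2_eq_2)
    moreover have "left_invariant (\<lambda>x. (\<psi> x + \<omega> x) / 2) \<subseteq> left_invariant \<psi> \<inter> left_invariant \<omega>"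
      using left_invariant_average[of \<psi> \<omega>] insert.prems \<omega>(1) K(1) by blast
    ultimately show ?case using \<omega>(2) by (intro bexI[of _ "\<lambda>x. (\<psi> x + \<omega> x) / 2"]) auto
  qed (use K(3) in auto)
  have "compact K" using compact_Int_closed[OF compact_states K(2)] K(1) by (simp add: Int_absorb1)
  hence "K \<inter> (\<Inter>\<psi>\<in>K. left_invariant \<psi>) \<noteq> {}"
  proof (rule compact_imp_fip_image)
    fix F assume "finite F" "F \<subseteq> K"
    then obtain \<omega> where \<omega>: "\<omega> \<in> K" "left_invariant \<omega> \<subseteq> (\<Inter>\<psi>\<in>F. left_invariant \<psi>)"
      using dominating by blast
    have "K \<inter> left_invariant \<omega> \<noteq> {}"
      by (rule left_invariant_meets[OF K(1,2) \<omega>(1) conv[OF \<omega>(1)] average])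
    with \<omega>(2) show "K \<inter> (\<Inter>\<psi>\<in>F. left_invariant \<psi>) \<noteq> {}" by blast
  qed (rule closed_left_invariant)
  with that show ?thesis by blast
qed

section \<open>From left invariance to two-sided invariance\<close>

lemma conv_left_invariant:
  assumes "\<psi> \<in> states" "h \<in> states" "h \<in> left_invariant \<psi>"
  shows "conv \<psi> h = h"
  by (rule states_eqI) (use assms in \<open>auto simp: conv_state conv_entry left_invariant_def\<close>)

text \<open>Each column of \<open>h\<close> is a fixed vector of the contraction given by
  \<open>\<psi>\<close>, hence also of its adjoint.\<close>

lemma left_invariant_adjoint:
  assumes "\<psi> \<in> states" "h \<in> left_invariant \<psi>" "I \<in> words n" "J \<in> words n"
  shows "(\<Sum>L\<in>words n. cnj (\<psi> (entry L I)) * h (entry L J)) = h (entry I J)"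
  by (rule contraction_fixed_adjoint[OF finite_words contraction_entry[OF assms(1)] _ assms(3)])
    (use assms in \<open>auto simp: left_invariant_def\<close>)

text \<open>On each tensor power \<open>h\<close> acts as an orthogonal projection, so its matrix is Hermitian and
  left invariance can be transposed.\<close>

lemma conv_right_invariant:
  assumes \<psi>: "\<psi> \<in> states" and h: "h \<in> states" and inv: "h \<in> left_invariant \<psi>" "h \<in> left_invariant h"
  shows "conv h \<psi> = h"
proof (rule states_eqI)
  fix n I J assume I: "I \<in> words n" and J: "J \<in> words n"
  \<comment> \<open>Invariance of \<open>h\<close> under its own adjoint says that its matrix is the
    product of its adjoint with itself, which is Hermitian.\<close>
  have herm: "cnj (h (entry L M)) = h (entry M L)" if "L \<in> words n" "M \<in> words n" for L M
    using left_invariant_adjoint[OF h inv(2) that, symmetric] left_invariant_adjoint[OF h inv(2) that(2,1)]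
    by (simp add: mult.commute)
  have "conv h \<psi> (entry I J) = (\<Sum>L\<in>words n. h (entry I L) * \<psi> (entry L J))"
    by (rule conv_entry) fact+
  also have "\<dots> = (\<Sum>L\<in>words n. cnj (cnj (\<psi> (entry L J)) * h (entry L I)))"
    using I by (intro sum.cong) (auto simp: herm)
  also have "\<dots> = cnj (h (entry J I))"
    using left_invariant_adjoint[OF \<psi> inv(1) J I] by (simp only: cnj_sum[symmetric])
  finally show "conv h \<psi> (entry I J) = h (entry I J)" using I J by (simp add: herm)
qed (use \<psi> h conv_state in auto)

lemma state_u_nonneg:
  assumes "\<phi> \<in> states" "i \<in> {1..N}" "j \<in> {1..N}"
  shows "0 \<le> Re (\<phi> (u i j))" "\<phi> (u i j) = complex_of_real (Re (\<phi> (u i j)))"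
  using positive_functional.pos_Re[OF states_positive[OF assms(1)], of "u i j"]
    positive_functional.pos_of_real[OF states_positive[OF assms(1)], of "u i j"] assms(2,3)
  by (simp_all only: adj_u u_idem)

text \<open>\<open>h (u j j)\<close> is the sum of the squared moduli in column \<open>j\<close>. If
  it were 0, the whole column would vanish, although it sums to \<open>h 1 = 1\<close>.\<close>

lemma left_invariant_u_diagonal_pos:
  assumes h: "h \<in> states" "h \<in> left_invariant h" and j: "j \<in> {1..N}"
  shows "h (u j j) \<noteq> 0"
proof
  assume "h (u j j) = 0"
  moreover have "(\<Sum>k=1..N. cnj (h (u k j)) * h (u k j)) = h (u j j)"
    using left_invariant_adjoint[OF h, of "[j]" "Suc 0" "[j]"] j by (simp add: sum_words_1)
  ultimately have "(\<Sum>k=1..N. (cmod (h (u k j)))\<^sup>2) = 0"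
    using sum_cnj_mult_self[of "\<lambda>k. h (u k j)" "{1..N}"] by simp
  hence "h (u k j) = 0" if "k \<in> {1..N}" for k
    using that by (subst (asm) sum_nonneg_eq_0_iff) auto
  hence "(\<Sum>k=1..N. h (u k j)) = 0" by (intro sum.neutral) blast
  moreover have "(\<Sum>k=1..N. h (u k j)) = h 1"
    using positive_functional.sum[OF states_positive[OF h(1)], of "\<lambda>k. u k j" "{1..N}"] col_sum[OF j] by simp
  ultimately show False using states_one[OF h(1)] by simp
qed

section \<open>The states attached to a partition form a quasi-subgroup\<close>

lemma quasi_subgroup_partition_states:
  assumes P: "partition_on {1..N} P"
  shows "quasi_subgroup tens \<Delta> (partition_states N u P)"
proof -
  define K where "K = partition_states N u P"
  define rel where "rel i j \<longleftrightarrow> (\<exists>B\<in>P. i \<in> B \<and> j \<in> B)" for i j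
  have K_iff: "\<phi> \<in> K \<longleftrightarrow> \<phi> \<in> states \<and> (\<forall>i\<in>{1..N}. \<forall>j\<in>{1..N}. \<not> rel i j \<longrightarrow> \<phi> (u i j) = 0)" for \<phi>
    by (simp add: K_def partition_states_def rel_def)
  have rel_refl: "rel i i" if "i \<in> {1..N}" for i
    using that partition_onD1[OF P] by (auto simp: rel_def)
  have rel_trans: "rel i k" if "rel i j" "rel j k" for i j k
    using that partition_onD2[OF P] by (auto simp: rel_def disjoint_def)
  have K_states: "K \<subseteq> states" by (auto simp: K_iff)
  have "K = states \<inter> {\<phi>. \<forall>i. i \<in> {1..N} \<longrightarrow> (\<forall>j. j \<in> {1..N} \<longrightarrow> (\<not> rel i j \<longrightarrow> \<phi> (u i j) = 0))}"
    by (auto simp: K_iff)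
  also have "closed \<dots>"
    by (intro closed_Int closed_states closed_Collect_all closed_Collect_imp open_Collect_const
        closed_Collect_eq continuous_eval continuous_intros)
  finally have closed_K: "closed K" .
  obtain \<epsilon> where "\<epsilon> \<in> states" "\<And>i j. i \<in> {1..N} \<Longrightarrow> j \<in> {1..N} \<Longrightarrow> \<epsilon> (u i j) = (if i = j then 1 else 0)"
    using counit_state by blast
  hence "\<epsilon> \<in> K" using rel_refl by (auto simp: K_iff)
  hence K_ne: "K \<noteq> {}" by blast
  have K_conv: "conv \<phi> \<psi> \<in> K" if "\<phi> \<in> K" "\<psi> \<in> K" for \<phi> \<psi>
    unfolding K_iff
  proof (intro conjI ballI impI)
    show "conv \<phi> \<psi> \<in> states" using that by (auto simp: K_iff intro: conv_state)
    fix i j assume ij: "i \<in> {1..N}" "j \<in> {1..N}" "\<not> rel i j"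
    \<comment> \<open>By transitivity \<open>k\<close> cannot be related to both \<open>i\<close>
      and \<open>j\<close>, so one factor vanishes.\<close>
    have "\<phi> (u i k) * \<psi> (u k j) = 0" if "k \<in> {1..N}" for k
      using that ij rel_trans[of i k j] \<open>\<phi> \<in> K\<close> \<open>\<psi> \<in> K\<close> unfolding K_iff mult_eq_0_iff by blast
    hence "(\<Sum>k=1..N. \<phi> (u i k) * \<psi> (u k j)) = 0" by (intro sum.neutral) blast
    thus "conv \<phi> \<psi> (u i j) = 0"
      using conv_u[of \<phi> \<psi> i j] ij that by (simp add: K_iff)
  qed
  have K_average: "(\<lambda>x. (\<Sum>k<m. \<phi> k x) / of_nat m) \<in> K" if "0 < m" "\<And>k. k < m \<Longrightarrow> \<phi> k \<in> K" for m \<phi>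
    using that average_states[of m \<phi>] by (auto simp: K_iff)
  obtain h where h: "h \<in> K" and inv: "\<And>\<psi>. \<psi> \<in> K \<Longrightarrow> h \<in> left_invariant \<psi>"
    using invariant_state_exists[OF K_states closed_K K_ne K_conv K_average] by blast
  have hs: "h \<in> states" using h by (simp add: K_iff)
  have fixed: "conv \<psi> h = h" "conv h \<psi> = h" if "\<psi> \<in> K" for \<psi>
    using that inv h by (auto simp: K_iff intro!: conv_left_invariant conv_right_invariant)
  have "\<psi> \<in> K" if \<psi>: "\<psi> \<in> states" and "conv \<psi> h = h" for \<psi>
    unfolding K_iff
  proof (intro conjI ballI impI)
    fix i j assume ij: "i \<in> {1..N}" "j \<in> {1..N}" "\<not> rel i j"
    \<comment> \<open>The sum is \<open>h (u i j)\<close>, which is 0 because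
      \<open>h \<in> K\<close>. Its terms are nonnegative reals, so the term \<open>k = j\<close>
      vanishes, and its factor \<open>h (u j j)\<close> is nonzero.\<close>
    have "(\<Sum>k=1..N. \<psi> (u i k) * h (u k j)) = 0"
      using conv_u[OF \<psi> hs ij(1,2)] that(2) h ij by (simp add: K_iff)
    moreover have "\<psi> (u i k) * h (u k j) = complex_of_real (Re (\<psi> (u i k)) * Re (h (u k j)))"
      if "k \<in> {1..N}" for k
      using state_u_nonneg(2)[OF \<psi> ij(1) that] state_u_nonneg(2)[OF hs that ij(2)]
      by (metis of_real_mult)
    ultimately have "complex_of_real (\<Sum>k=1..N. Re (\<psi> (u i k)) * Re (h (u k j))) = 0"
      unfolding of_real_sum by (metis (no_types, lifting) sum.cong)
    hence "(\<Sum>k=1..N. Re (\<psi> (u i k)) * Re (h (u k j))) = 0" by (simp only: of_real_eq_0_iff)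
    hence "Re (\<psi> (u i j)) * Re (h (u j j)) = 0"
      using ij(2) by (subst (asm) sum_nonneg_eq_0_iff)
        (simp_all only: finite_atLeastAtMost mult_nonneg_nonneg state_u_nonneg(1) \<psi> hs ij)
    moreover have "Re (h (u j j)) \<noteq> 0"
      using left_invariant_u_diagonal_pos[OF hs inv[OF h] ij(2)] state_u_nonneg(2)[OF hs ij(2) ij(2)]
      by (metis of_real_0)
    ultimately show "\<psi> (u i j) = 0"
      using state_u_nonneg(2)[OF \<psi> ij(1,2)] by simp
  qed (rule \<psi>)
  hence "{\<psi> \<in> states. conv \<psi> h = h \<and> h = conv h \<psi>} \<subseteq> K" by blast
  moreover have "K \<subseteq> {\<psi> \<in> states. conv \<psi> h = h \<and> h = conv h \<psi>}"
    using K_states by (auto simp: fixed)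
  ultimately have "K = {\<psi> \<in> states. conv \<psi> h = h \<and> h = conv h \<psi>}" by (rule equalityI[rotated])
  thus ?thesis
    using hs fixed[OF h] unfolding quasi_subgroup_def idempotent_state_def K_def by blast
qed

end

theorem theorem3p1:
  fixes tens :: "'a::cstar_algebra \<Rightarrow> 'a \<Rightarrow> 'b::cstar_algebra"
    and tensL :: "'b \<Rightarrow> 'a \<Rightarrow> 'c::cstar_algebra"
    and tensR :: "'a \<Rightarrow> 'b \<Rightarrow> 'c"
    and \<Delta> :: "'a \<Rightarrow> 'b"
    and N :: nat
    and u :: "nat \<Rightarrow> nat \<Rightarrow> 'a"
    and P :: "nat set set"
  assumes "quantum_permutation_group tens tensL tensR \<Delta> N u"
    and "partition_on {1..N} P"
  shows "quasi_subgroup tens \<Delta> (partition_states N u P)"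
  using assms by (rule quantum_permutation_group.quasi_subgroup_partition_states)

end
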